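(* For $N\ge2$: (i) $(\widehat\theta,\widehat\alpha^{\,2})$ is a complete sufficient statistic for $(\theta,\alpha^{2})\in\mathbb R\times(0,\infty)$; (ii) $\widehat\theta$ is the uniformly minimum variance unbiased (UMVU) estimator of $\theta$; (iii) $\widetilde\alpha^{\,2}=\frac{N}{N-1}\widehat\alpha^{\,2}$ is the UMVU estimator of $\alpha^{2}$, and $\widehat\alpha/b_N$ is the UMVU estimator of $\alpha$, where $\widehat\alpha=\sqrt{\widehat\alpha^{\,2}}$ and $b_N=\sqrt{\frac2N}\,\frac{\Gamma(N/2)}{\Gamma((N-1)/2)}$ with $\Gamma(\cdot)$ the Euler Gamma function.
   Context: Fix a mesh $h>0$, an integer $m\ge1$ and known Hurst parameters $H_1,\dots,H_m\in(1/2,1)$. Let $B^{H_1},\dots,B^{H_m}$ be independent fractional Brownian motions, i.e. independent centred continuous Gaussian processes with $B^{H_r}(0)=0$ and $\mathbb E[B^{H_r}(t)B^{H_r}(s)]=\frac12(t^{2H_r}+s^{2H_r}-|t-s|^{2H_r})$ for $s,t\ge0$. For unknown $\theta\in\mathbb R$ and $\alpha>0$ set $Z(t)=\theta t+\alpha\sum_{r=1}^m B^{H_r}(t)$, $t_k=kh$, $\mathbf T=(t_1,\dots,t_N)^\top$, $\mathbf Z=(Z(t_1),\dots,Z(t_N))^\top$. Let $\Gamma_H=\sum_{r=1}^m\Gamma_{H_r}$ be the $N\times N$ positive definite matrix with $(\Gamma_{H_r})_{ij}=\frac12(t_i^{2H_r}+t_j^{2H_r}-|t_i-t_j|^{2H_r})$.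 The statistical model is the family of laws $\mathbf Z\sim\mathcal N(\theta\mathbf T,\alpha^2\Gamma_H)$ on $\mathbb R^N$ indexed by $(\theta,\alpha^2)\in\mathbb R\times(0,\infty)$. Put $d_N=\mathbf T^\top\Gamma_H^{-1}\mathbf T>0$ and $$\widehat\theta=\frac{\mathbf T^\top\Gamma_H^{-1}\mathbf Z}{d_N},\qquad \widehat\alpha^{\,2}=\frac1N\left(\mathbf Z^\top\Gamma_H^{-1}\mathbf Z-\frac{(\mathbf T^\top\Gamma_H^{-1}\mathbf Z)^2}{d_N}\right).$$ *)

theory Defs
  imports "HOL-Probability.Probability"
begin

section \<open>Statistical models\<close>

text \<open>A model is a family \<open>P\<close> of probability measures, indexed by a parameter set \<open>\<Theta>\<close>, all of them
  carried by the measurable space \<open>X\<close>. A statistic with values in the measurable space \<open>Y\<close> is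
  an element of \<open>X \<rightarrow>\<^sub>M Y\<close>.\<close>

text \<open>Sufficiency: for each event there is a version of its conditional probability given \<open>S\<close>
  that does not depend on the parameter.\<close>

definition sufficient_statistic ::
  "'x measure \<Rightarrow> 'p set \<Rightarrow> ('p \<Rightarrow> 'x measure) \<Rightarrow> 's measure \<Rightarrow> ('x \<Rightarrow> 's) \<Rightarrow> bool" where
  "sufficient_statistic X \<Theta> P Y S \<longleftrightarrow>
     S \<in> X \<rightarrow>\<^sub>M Y \<and>
     (\<forall>A\<in>sets X. \<exists>g\<in>borel_measurable Y. \<forall>p\<in>\<Theta>. AE x in P p.
        real_cond_exp (P p) (vimage_algebra (space X) S Y) (indicator A) x = g (S x))"

definition complete_statistic ::
  "'x measure \<Rightarrow> 'p set \<Rightarrow> ('p \<Rightarrow> 'x measure) \<Rightarrow> 's measure \<Rightarrow> ('x \<Rightarrow> 's) \<Rightarrow> bool" where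
  "complete_statistic X \<Theta> P Y S \<longleftrightarrow>
     S \<in> X \<rightarrow>\<^sub>M Y \<and>
     (\<forall>g :: 's \<Rightarrow> real. g \<in> borel_measurable Y \<longrightarrow>
        (\<forall>p\<in>\<Theta>. integrable (P p) (\<lambda>x. g (S x)) \<and> (\<integral>x. g (S x) \<partial>P p) = 0) \<longrightarrow>
        (\<forall>p\<in>\<Theta>. AE x in P p. g (S x) = 0))"

definition unbiased_estimator ::
  "'x measure \<Rightarrow> 'p set \<Rightarrow> ('p \<Rightarrow> 'x measure) \<Rightarrow> ('p \<Rightarrow> real) \<Rightarrow> ('x \<Rightarrow> real) \<Rightarrow> bool" where
  "unbiased_estimator X \<Theta> P \<tau> \<delta> \<longleftrightarrow>
     \<delta> \<in> borel_measurable X \<and>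
     (\<forall>p\<in>\<Theta>. integrable (P p) \<delta> \<and> (\<integral>x. \<delta> x \<partial>P p) = \<tau> p)"

text \<open>The variance is taken in \<open>[0,\<infinity>]\<close>: the Bochner integral would assign the value 0 to an
  infinite variance.\<close>

definition evariance :: "'x measure \<Rightarrow> ('x \<Rightarrow> real) \<Rightarrow> ennreal" where
  "evariance M f = (\<integral>\<^sup>+x. ennreal ((f x - (\<integral>y. f y \<partial>M))\<^sup>2) \<partial>M)"

definition umvu_estimator ::
  "'x measure \<Rightarrow> 'p set \<Rightarrow> ('p \<Rightarrow> 'x measure) \<Rightarrow> ('p \<Rightarrow> real) \<Rightarrow> ('x \<Rightarrow> real) \<Rightarrow> bool" where
  "umvu_estimator X \<Theta> P \<tau> \<delta> \<longleftrightarrow>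
     unbiased_estimator X \<Theta> P \<tau> \<delta> \<and>
     (\<forall>\<delta>'. unbiased_estimator X \<Theta> P \<tau> \<delta>' \<longrightarrow>
        (\<forall>p\<in>\<Theta>. evariance (P p) \<delta> \<le> evariance (P p) \<delta>'))"

text \<open>\<^emph>\<open>The\<close> UMVU estimator: unique up to null sets of every measure of the model.\<close>

definition the_umvu_estimator ::
  "'x measure \<Rightarrow> 'p set \<Rightarrow> ('p \<Rightarrow> 'x measure) \<Rightarrow> ('p \<Rightarrow> real) \<Rightarrow> ('x \<Rightarrow> real) \<Rightarrow> bool" where
  "the_umvu_estimator X \<Theta> P \<tau> \<delta> \<longleftrightarrow>
     umvu_estimator X \<Theta> P \<tau> \<delta> \<and>
     (\<forall>\<delta>'. umvu_estimator X \<Theta> P \<tau> \<delta>' \<longrightarrow> (\<forall>p\<in>\<Theta>. AE x in P p. \<delta>' x = \<delta> x))"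

section \<open>Normal laws\<close>

text \<open>The law \<open>N(\<mu>,\<Sigma>)\<close> for positive definite \<open>\<Sigma>\<close>, by its density.\<close>

definition multivariate_normal :: "real^'n::finite \<Rightarrow> real^'n^'n \<Rightarrow> (real^'n) measure" where
  "multivariate_normal \<mu> \<Sigma> = density lborel (\<lambda>z. ennreal (
     exp (- ((z - \<mu>) \<bullet> (matrix_inv \<Sigma> *v (z - \<mu>))) / 2) / sqrt ((2 * pi) ^ CARD('n) * det \<Sigma>)))"

section \<open>Discretely observed mixed fractional Brownian motion with drift\<close>

text \<open>The coordinates of the sample space \<open>real^'n\<close> are numbered by a bijection \<open>k\<close> from \<open>'n\<close> onto
  \<open>{1..N}\<close>, where \<open>N = CARD('n)\<close>; coordinate \<open>i\<close> is the observation at time \<open>k i * h\<close>.\<close>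

definition obs_times :: "real \<Rightarrow> ('n::finite \<Rightarrow> nat) \<Rightarrow> real^'n" where
  "obs_times h k = (\<chi> i. real (k i) * h)"

text \<open>Covariance function of fractional Brownian motion with Hurst parameter \<open>H\<close>.\<close>

definition fbm_cov :: "real \<Rightarrow> real \<Rightarrow> real \<Rightarrow> real" where
  "fbm_cov H s t = (s powr (2 * H) + t powr (2 * H) - \<bar>s - t\<bar> powr (2 * H)) / 2"

definition mixed_cov :: "real \<Rightarrow> nat \<Rightarrow> (nat \<Rightarrow> real) \<Rightarrow> ('n::finite \<Rightarrow> nat) \<Rightarrow> real^'n^'n" where
  "mixed_cov h m H k =
     (\<Sum>r = 1..m. \<chi> i j. fbm_cov (H r) (obs_times h k $ i) (obs_times h k $ j))"

text \<open>The second component of the parameter is \<open>\<alpha>\<^sup>2\<close>.\<close>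

definition param_space :: "(real \<times> real) set" where
  "param_space = UNIV \<times> {0<..}"

definition obs_law ::
  "real \<Rightarrow> nat \<Rightarrow> (nat \<Rightarrow> real) \<Rightarrow> ('n::finite \<Rightarrow> nat) \<Rightarrow> real \<times> real \<Rightarrow> (real^'n) measure" where
  "obs_law h m H k = (\<lambda>(\<theta>, \<alpha>2).
     multivariate_normal (\<theta> *\<^sub>R obs_times h k) (\<alpha>2 *\<^sub>R mixed_cov h m H k))"

definition d_N :: "real \<Rightarrow> nat \<Rightarrow> (nat \<Rightarrow> real) \<Rightarrow> ('n::finite \<Rightarrow> nat) \<Rightarrow> real" where
  "d_N h m H k = (let T = obs_times h k :: real^'n in
     T \<bullet> (matrix_inv (mixed_cov h m H k) *v T))"

definition theta_hat ::
  "real \<Rightarrow> nat \<Rightarrow> (nat \<Rightarrow> real) \<Rightarrow> ('n::finite \<Rightarrow> nat) \<Rightarrow> real^'n \<Rightarrow> real" where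
  "theta_hat h m H k Z =
     (obs_times h k \<bullet> (matrix_inv (mixed_cov h m H k) *v Z)) / d_N h m H k"

definition alpha_sq_hat ::
  "real \<Rightarrow> nat \<Rightarrow> (nat \<Rightarrow> real) \<Rightarrow> ('n::finite \<Rightarrow> nat) \<Rightarrow> real^'n \<Rightarrow> real" where
  "alpha_sq_hat h m H k Z = 1 / real CARD('n) *
     (Z \<bullet> (matrix_inv (mixed_cov h m H k) *v Z)
      - (obs_times h k \<bullet> (matrix_inv (mixed_cov h m H k) *v Z))\<^sup>2 / d_N h m H k)"

definition alpha_hat ::
  "real \<Rightarrow> nat \<Rightarrow> (nat \<Rightarrow> real) \<Rightarrow> ('n::finite \<Rightarrow> nat) \<Rightarrow> real^'n \<Rightarrow> real" where
  "alpha_hat h m H k Z = sqrt (alpha_sq_hat h m H k Z)"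

definition b_N :: "nat \<Rightarrow> real" where
  "b_N N = sqrt (2 / real N) * (Gamma (real N / 2) / Gamma ((real N - 1) / 2))"

end

theory Submission
  imports Defs
begin

text \<open>Since \<open>mixed_cov\<close> is positive definite, it factors as \<open>C ** transpose C\<close> with the observation times
  proportional to one column of \<open>C\<close>. In the coordinates \<open>y\<close> with \<open>Z = C *v y\<close> the observations are
  independent normal variables of variance \<open>\<alpha>\<^sup>2\<close>, only one of which carries the drift: that coordinate
  gives \<open>theta_hat\<close>, and the sum of squares of the others gives \<open>alpha_sq_hat\<close>. The likelihood depends on
  \<open>Z\<close> through these two quantities only, which is sufficiency. It is a two-parameter exponential family,
  so a function of the statistic with zero mean for all parameters has vanishing moments with respect
  to two bounded variables that determine the statistic, which is completeness. The Lehmann--Scheffe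
  theorem then reduces each claim on UMVU estimators to the computation of a mean.\<close>

section \<open>Conditional expectations and unbiased estimators in a factorized model\<close>

text \<open>The laws are given by densities containing \<open>matrix_inv\<close> and
  \<open>det\<close>, from which means are hard to compute; rewriting every law as an affine image
  of one standard normal vector requires the transformation formula of Lebesgue measure under
  invertible matrices. Conditional expectations depend on the measure, whereas sufficiency and
  Rao-Blackwell improvement need one version for all parameters; a member of the model serves as
  dominating measure, so that every likelihood ratio is a function of the statistic. Completeness
  uses only countably many parameters: \<theta> / v = i and 1 / v = 1 + 2 * (i + j) turn the
  likelihood ratio into a multiple of a monomial, so uniform polynomial approximation on a compact
  set replaces uniqueness of Laplace transforms. The constant \<open>b_N\<close> is the mean of
  \<open>alpha_hat\<close> at unit variance; it comes from Gamma integrals, without identifying a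
  chi-square law. Positive definiteness is seen in the frequency domain: a degenerate form would
  give a nonzero polynomial with infinitely many zeros on the unit circle.\<close>

lemma measurable_vimage_algebra_factor_nonneg:
  fixes f :: "'a \<Rightarrow> real"
  assumes S: "S \<in> X \<rightarrow> space Y" and f: "f \<in> borel_measurable (vimage_algebra X S Y)"
    and nn: "\<And>x. 0 \<le> f x"
  shows "\<exists>g\<in>borel_measurable Y. \<forall>x\<in>X. f x = g (S x)"
  using f nn
proof (induction rule: borel_measurable_induct_real)
  case (set A)
  then obtain B where B: "B \<in> sets Y" "A = S -` B \<inter> X"
    using sets_vimage_algebra2[OF S] by auto
  then show ?case
    by (intro bexI[of _ "indicator B"]) (auto simp: indicator_def)
next
  case (mult u c)
  then obtain g where "g \<in> borel_measurable Y" "\<forall>x\<in>X. u x = g (S x)" by blast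
  then show ?case by (intro bexI[of _ "\<lambda>y. c * g y"]) (simp, measurable)
next
  case (add u v)
  then obtain g g' where "g \<in> borel_measurable Y" "\<forall>x\<in>X. u x = g (S x)"
    "g' \<in> borel_measurable Y" "\<forall>x\<in>X. v x = g' (S x)" by blast
  then show ?case by (intro bexI[of _ "\<lambda>y. g' y + g y"]) (simp, measurable)
next
  case (seq U)
  have "\<forall>i. \<exists>g. g \<in> borel_measurable Y \<and> (\<forall>x\<in>X. U i x = g (S x))"
    using seq.IH by blast
  from choice[OF this] obtain g
    where g: "\<And>i. g i \<in> borel_measurable Y" "\<And>i x. x \<in> X \<Longrightarrow> U i x = g i (S x)"
    by blast
  show ?case
  \<comment> \<open>Off the image of \<open>S\<close> the sequence \<open>g i y\<close> may diverge;
    \<open>lim\<close> is still measurable there, and only its values on the image matter.\<close>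
  proof (intro bexI[of _ "\<lambda>y. lim (\<lambda>i. g i y)"] ballI)
    show "(\<lambda>y. lim (\<lambda>i. g i y)) \<in> borel_measurable Y"
      using g(1) by measurable
    fix x assume x: "x \<in> X"
    then have "(\<lambda>i. U i x) \<longlonglongrightarrow> f x" using seq.hyps by simp
    then show "f x = lim (\<lambda>i. g i (S x))"
      using g(2)[OF x] by (simp add: limI)
  qed
qed

text \<open>The Doob-Dynkin lemma. The induction over simple functions and monotone limits works for
  nonnegative functions, so positive and negative parts are factored separately.\<close>

lemma measurable_vimage_algebra_factor:
  fixes f :: "'a \<Rightarrow> real"
  assumes S: "S \<in> X \<rightarrow> space Y" and f: "f \<in> borel_measurable (vimage_algebra X S Y)"
  shows "\<exists>g\<in>borel_measurable Y. \<forall>x\<in>X. f x = g (S x)"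
proof -
  have "(\<lambda>x. max 0 (f x)) \<in> borel_measurable (vimage_algebra X S Y)"
    "(\<lambda>x. max 0 (- f x)) \<in> borel_measurable (vimage_algebra X S Y)"
    using f by measurable
  from measurable_vimage_algebra_factor_nonneg[OF S this(1)]
    measurable_vimage_algebra_factor_nonneg[OF S this(2)]
  obtain g g' where g: "g \<in> borel_measurable Y" "\<forall>x\<in>X. max 0 (f x) = g (S x)"
    "g' \<in> borel_measurable Y" "\<forall>x\<in>X. max 0 (- f x) = g' (S x)"
    by (metis max.cobounded1)
  show ?thesis
  proof (intro bexI[of _ "\<lambda>y. g y - g' y"] ballI)
    fix x assume "x \<in> X"
    then have "max 0 (f x) = g (S x)" "max 0 (- f x) = g' (S x)" using g by auto
    then show "f x = g (S x) - g' (S x)" by linarith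
  next
    show "(\<lambda>y. g y - g' y) \<in> borel_measurable Y" using g(1,3) by measurable
  qed
qed

lemma vimage_algebra_finite_measure_subalgebra:
  assumes "finite_measure M" "S \<in> M \<rightarrow>\<^sub>M Y"
  shows "finite_measure_subalgebra M (vimage_algebra (space M) S Y)"
  using assms sets_image_in_sets[OF refl assms(2)]
  by (auto simp: finite_measure_subalgebra_def finite_measure_subalgebra_axioms_def subalgebra_def)

text \<open>One \<open>g\<close> serves all densities \<open>h \<circ> S\<close>, because \<open>h \<circ> S\<close> is measurable with respect to the
  \<open>\<sigma>\<close>-algebra generated by \<open>S\<close> and can be taken out of the conditional expectation.\<close>

lemma real_cond_exp_density_factor:
  fixes f :: "'a \<Rightarrow> real"
  assumes M: "finite_measure M" and S: "S \<in> M \<rightarrow>\<^sub>M Y" and f: "integrable M f"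
  shows "\<exists>g\<in>borel_measurable Y. \<forall>h :: 'b \<Rightarrow> real. h \<in> borel_measurable Y \<longrightarrow> (\<forall>y. 0 \<le> h y) \<longrightarrow>
    finite_measure (density M (\<lambda>x. ennreal (h (S x)))) \<longrightarrow>
    integrable (density M (\<lambda>x. ennreal (h (S x)))) f \<longrightarrow>
    (AE x in density M (\<lambda>x. ennreal (h (S x))).
      real_cond_exp (density M (\<lambda>x. ennreal (h (S x)))) (vimage_algebra (space M) S Y) f x = g (S x))"
proof -
  let ?F = "vimage_algebra (space M) S Y"
  interpret M: finite_measure_subalgebra M ?F
    by (rule vimage_algebra_finite_measure_subalgebra) fact+
  have S': "S \<in> space M \<rightarrow> space Y" using S by (auto dest: measurable_space)
  have SF: "S \<in> ?F \<rightarrow>\<^sub>M Y" by (rule measurable_vimage_algebra1[OF S'])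
  obtain g where g[measurable]: "g \<in> borel_measurable Y"
    and gx: "\<And>x. x \<in> space M \<Longrightarrow> real_cond_exp M ?F f x = g (S x)"
    using measurable_vimage_algebra_factor[OF S' borel_measurable_cond_exp[of M ?F f]] by blast
  show ?thesis
  proof (rule bexI[OF _ g], intro allI impI)
    fix h :: "'b \<Rightarrow> real"
    assume h[measurable]: "h \<in> borel_measurable Y" and h0: "\<forall>y. 0 \<le> h y"
    let ?D = "density M (\<lambda>x. ennreal (h (S x)))"
    assume fin: "finite_measure ?D" and fD: "integrable ?D f"
    note S[measurable] SF[measurable]
    have fm[measurable]: "f \<in> borel_measurable M" using f by simp
    interpret D: finite_measure_subalgebra ?D ?F
      using vimage_algebra_finite_measure_subalgebra[OF fin, of S Y] S by simp
    have hf: "integrable M (\<lambda>x. h (S x) * f x)"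
      using fD h0 by (subst (asm) integrable_density) auto
    have key: "integrable M (\<lambda>x. indicator A x * h (S x) * real_cond_exp M ?F f x)"
      "(\<integral>x. indicator A x * h (S x) * real_cond_exp M ?F f x \<partial>M)
        = (\<integral>x. indicator A x * h (S x) * f x \<partial>M)"
      if A[measurable]: "A \<in> sets ?F" for A
    proof -
      have AM: "A \<in> sets M" using A M.subalg by (auto simp: subalgebra_def)
      have "integrable M (\<lambda>x. indicator A x * (h (S x) * f x))"
        using integrable_mult_indicator[OF AM hf] by simp
      then have i: "integrable M (\<lambda>x. (indicator A x * h (S x)) * f x)" by (simp add: mult.assoc)
      have m: "(\<lambda>x. indicator A x * h (S x)) \<in> borel_measurable ?F" by measurable
      show "integrable M (\<lambda>x. indicator A x * h (S x) * real_cond_exp M ?F f x)"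
        "(\<integral>x. indicator A x * h (S x) * real_cond_exp M ?F f x \<partial>M)
        = (\<integral>x. indicator A x * h (S x) * f x \<partial>M)"
        using M.real_cond_exp_intg[OF i m fm] by auto
    qed
    show "AE x in ?D. real_cond_exp ?D ?F f x = g (S x)"
    proof (rule D.real_cond_exp_charact)
      fix A assume A: "A \<in> sets ?F"
      then have AM[measurable]: "A \<in> sets M" using M.subalg by (auto simp: subalgebra_def)
      have "(\<integral>x\<in>A. f x \<partial>?D) = (\<integral>x. indicator A x * h (S x) * f x \<partial>M)"
        unfolding set_lebesgue_integral_def using h0
        by (subst integral_density) (auto simp: ac_simps)
      also have "\<dots> = (\<integral>x. indicator A x * h (S x) * g (S x) \<partial>M)"
        unfolding key(2)[OF A, symmetric] by (intro Bochner_Integration.integral_cong) (auto simp: gx)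
      also have "\<dots> = (\<integral>x\<in>A. g (S x) \<partial>?D)"
        unfolding set_lebesgue_integral_def using h0
        by (subst integral_density) (auto simp: ac_simps)
      finally show "(\<integral>x\<in>A. f x \<partial>?D) = (\<integral>x\<in>A. g (S x) \<partial>?D)" .
    next
      show "integrable ?D f" by fact
      \<comment> \<open>With the whole space in place of \<open>A\<close>, \<open>key\<close> yields
        the integrability of \<open>g (S x)\<close> under the new density.\<close>
      have "space M \<in> sets ?F" by (metis sets.top space_vimage_algebra)
      from key(1)[OF this] have "integrable M (\<lambda>x. h (S x) * g (S x))"
        by (subst (asm) Bochner_Integration.integrable_cong[OF refl, where g="\<lambda>x. h (S x) * g (S x)"])
           (auto simp: gx)
      then show "integrable ?D (\<lambda>x. g (S x))"
        using h0 by (subst integrable_density) auto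
      show "(\<lambda>x. g (S x)) \<in> borel_measurable ?F" by measurable
    qed
  qed
qed

text \<open>Fisher-Neyman factorization with a member \<open>P p0\<close> of the model as dominating
  measure. This absorbs the factor of the density that does not depend on the parameter, so each
  remaining density is a function of \<open>S\<close> alone.\<close>

definition factorized_model ::
  "'x measure \<Rightarrow> 'p set \<Rightarrow> ('p \<Rightarrow> 'x measure) \<Rightarrow> 's measure \<Rightarrow> ('x \<Rightarrow> 's) \<Rightarrow> bool" where
  "factorized_model X \<Theta> P Y S \<longleftrightarrow>
     S \<in> X \<rightarrow>\<^sub>M Y \<and> (\<forall>p\<in>\<Theta>. prob_space (P p)) \<and>
     (\<exists>p0\<in>\<Theta>. sets (P p0) = sets X \<and>
       (\<forall>p\<in>\<Theta>. \<exists>h :: 's \<Rightarrow> real. h \<in> borel_measurable Y \<and> (\<forall>y. 0 \<le> h y) \<and>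
          P p = density (P p0) (\<lambda>x. ennreal (h (S x)))))"

text \<open>Stated for general integrable \<open>f\<close> because it serves twice: indicators give
  sufficiency, and an arbitrary unbiased estimator gives its Rao-Blackwell improvement.\<close>

lemma factorized_model_cond_exp:
  fixes f :: "'x \<Rightarrow> real" and S :: "'x \<Rightarrow> 's"
  assumes mod: "factorized_model X \<Theta> P Y S" and f: "\<forall>p\<in>\<Theta>. integrable (P p) f"
  shows "\<exists>g\<in>borel_measurable Y. \<forall>p\<in>\<Theta>. AE x in P p.
    real_cond_exp (P p) (vimage_algebra (space X) S Y) f x = g (S x)"
proof -
  from mod obtain p0 where S: "S \<in> X \<rightarrow>\<^sub>M Y" and prob: "\<forall>p\<in>\<Theta>. prob_space (P p)"
    and p0: "p0 \<in> \<Theta>" "sets (P p0) = sets X"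
    and h: "\<forall>p\<in>\<Theta>. \<exists>h :: 's \<Rightarrow> real. h \<in> borel_measurable Y \<and> (\<forall>y. 0 \<le> h y) \<and>
          P p = density (P p0) (\<lambda>x. ennreal (h (S x)))"
    unfolding factorized_model_def by blast
  have sp: "space (P p0) = space X" using p0(2) by (rule sets_eq_imp_space_eq)
  have fin: "finite_measure (P p)" if "p \<in> \<Theta>" for p
    using prob that by (auto simp: prob_space.finite_measure)
  have S0: "S \<in> P p0 \<rightarrow>\<^sub>M Y" using S measurable_cong_sets[OF p0(2) refl] by blast
  obtain g where g: "g \<in> borel_measurable Y" and
    *: "\<And>h. h \<in> borel_measurable Y \<Longrightarrow> (\<forall>y. 0 \<le> h y) \<Longrightarrow>
    finite_measure (density (P p0) (\<lambda>x. ennreal (h (S x)))) \<Longrightarrow>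
    integrable (density (P p0) (\<lambda>x. ennreal (h (S x)))) f \<Longrightarrow>
    (AE x in density (P p0) (\<lambda>x. ennreal (h (S x))).
      real_cond_exp (density (P p0) (\<lambda>x. ennreal (h (S x)))) (vimage_algebra (space (P p0)) S Y) f x
        = g (S x))"
    using real_cond_exp_density_factor[OF fin[OF p0(1)] S0, of f] f p0(1) by blast
  show ?thesis
  proof (intro bexI[OF _ g] ballI)
    fix p assume p: "p \<in> \<Theta>"
    then obtain h where hh: "h \<in> borel_measurable Y" "\<forall>y. 0 \<le> h y"
      "P p = density (P p0) (\<lambda>x. ennreal (h (S x)))" using h by blast
    show "AE x in P p. real_cond_exp (P p) (vimage_algebra (space X) S Y) f x = g (S x)"
      using *[OF hh(1,2)] fin[OF p] f p unfolding hh(3)[symmetric] sp by blast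
  qed
qed

lemma factorized_model_sets:
  assumes "factorized_model X \<Theta> P Y S" "p \<in> \<Theta>"
  shows "sets (P p) = sets X"
  using assms unfolding factorized_model_def by (metis sets_density)

lemma factorized_model_sufficient:
  assumes mod: "factorized_model X \<Theta> P Y S"
  shows "sufficient_statistic X \<Theta> P Y S"
  unfolding sufficient_statistic_def
proof (intro conjI ballI)
  show "S \<in> X \<rightarrow>\<^sub>M Y" using mod by (simp add: factorized_model_def)
  fix A assume A: "A \<in> sets X"
  have "\<forall>p\<in>\<Theta>. integrable (P p) (indicator A :: _ \<Rightarrow> real)"
  proof
    fix p assume p: "p \<in> \<Theta>"
    then interpret prob_space "P p" using mod by (simp add: factorized_model_def)
    show "integrable (P p) (indicator A :: _ \<Rightarrow> real)"
      using A factorized_model_sets[OF mod p]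
      by (intro integrable_real_indicator) (auto simp: emeasure_eq_measure)
  qed
  from factorized_model_cond_exp[OF mod this]
  show "\<exists>g\<in>borel_measurable Y. \<forall>p\<in>\<Theta>. AE x in P p.
        real_cond_exp (P p) (vimage_algebra (space X) S Y) (indicator A) x = g (S x)" .
qed

section \<open>Variances and optimality of unbiased functions of a complete sufficient
  statistic\<close>

lemma evariance_eq_integral:
  assumes "integrable M (\<lambda>x. (f x - integral\<^sup>L M f)\<^sup>2)"
  shows "evariance M f = ennreal (\<integral>x. (f x - integral\<^sup>L M f)\<^sup>2 \<partial>M)"
  unfolding evariance_def using assms by (intro nn_integral_eq_integral) auto

lemma integrable_square_add:
  fixes f g :: "'a \<Rightarrow> real"
  assumes [measurable]: "f \<in> borel_measurable M" "g \<in> borel_measurable M"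
    and "integrable M (\<lambda>x. (f x)\<^sup>2)" "integrable M (\<lambda>x. (g x)\<^sup>2)"
  shows "integrable M (\<lambda>x. f x * g x)" "integrable M (\<lambda>x. (f x - g x)\<^sup>2)"
proof -
  show p: "integrable M (\<lambda>x. f x * g x)"
  proof (rule Bochner_Integration.integrable_bound)
    show "integrable M (\<lambda>x. (f x)\<^sup>2 + (g x)\<^sup>2)" using assms by simp
    have "norm (f x * g x) \<le> norm ((f x)\<^sup>2 + (g x)\<^sup>2)" for x
      using sum_squares_bound[of "\<bar>f x\<bar>" "\<bar>g x\<bar>"] by (auto simp: abs_mult intro: order_trans[rotated])
    then show "AE x in M. norm (f x * g x) \<le> norm ((f x)\<^sup>2 + (g x)\<^sup>2)" by simp
  qed measurable
  have "integrable M (\<lambda>x. (f x)\<^sup>2 + (g x)\<^sup>2 - 2 * (f x * g x))" using assms p by simp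
  then show "integrable M (\<lambda>x. (f x - g x)\<^sup>2)" by (simp add: power2_diff mult.assoc)
qed

text \<open>The Lehmann--Scheffe theorem. Square integrability is needed for uniqueness only:
  if the variance is infinite, equality of variances carries no information.\<close>

lemma factorized_model_complete_umvu:
  fixes \<phi> :: "'s \<Rightarrow> real"
  assumes mod: "factorized_model X \<Theta> P Y S" and com: "complete_statistic X \<Theta> P Y S"
    and phi: "\<phi> \<in> borel_measurable Y"
    and unb: "unbiased_estimator X \<Theta> P \<tau> (\<lambda>x. \<phi> (S x))"
    and sq: "\<And>p. p \<in> \<Theta> \<Longrightarrow> integrable (P p) (\<lambda>x. (\<phi> (S x))\<^sup>2)"
  shows "the_umvu_estimator X \<Theta> P \<tau> (\<lambda>x. \<phi> (S x))"
proof -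
  let ?F = "vimage_algebra (space X) S Y"
  let ?\<delta> = "\<lambda>x. \<phi> (S x)"
  have S: "S \<in> X \<rightarrow>\<^sub>M Y" using mod by (simp add: factorized_model_def)
  \<comment> \<open>Pythagoras for a competitor of finite variance: its variance exceeds that of
    \<open>?\<delta>\<close> by the mean square of the difference. Nonnegativity of this excess
    gives optimality, and its vanishing under equal variances gives uniqueness.\<close>
  have var: "evariance (P p) ?\<delta> = ennreal (\<integral>x. (?\<delta> x - \<tau> p)\<^sup>2 \<partial>P p)"
    and var': "evariance (P p) \<delta>' = evariance (P p) ?\<delta> + ennreal (\<integral>x. (\<delta>' x - ?\<delta> x)\<^sup>2 \<partial>P p)"
    and i': "integrable (P p) (\<lambda>x. (\<delta>' x - ?\<delta> x)\<^sup>2)"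
    if p: "p \<in> \<Theta>" and u: "unbiased_estimator X \<Theta> P \<tau> \<delta>'"
      and fin: "evariance (P p) \<delta>' \<noteq> \<infinity>" for p \<delta>'
  proof -
    interpret prob_space "P p" using mod p by (simp add: factorized_model_def)
    note sets[measurable_cong] = factorized_model_sets[OF mod p]
    have sp: "space (P p) = space X" using sets by (rule sets_eq_imp_space_eq)
    have SP[measurable]: "S \<in> P p \<rightarrow>\<^sub>M Y" using S by simp
    note phi[measurable]
    have ud: "integrable (P p) \<delta>'" "integral\<^sup>L (P p) \<delta>' = \<tau> p" "\<forall>p\<in>\<Theta>. integrable (P p) \<delta>'"
      using u p by (auto simp: unbiased_estimator_def)
    have up: "integrable (P p) ?\<delta>" "integral\<^sup>L (P p) ?\<delta> = \<tau> p"
      using unb p by (auto simp: unbiased_estimator_def)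
    have [measurable]: "\<delta>' \<in> borel_measurable (P p)" using ud by simp
    interpret F: finite_measure_subalgebra "P p" ?F
      using vimage_algebra_finite_measure_subalgebra[OF finite_measure_axioms SP] by (simp add: sp)
    have SF[measurable]: "S \<in> ?F \<rightarrow>\<^sub>M Y"
      using measurable_space[OF S] by (intro measurable_vimage_algebra1) auto
    have sqd: "integrable (P p) (\<lambda>x. (\<delta>' x - \<tau> p)\<^sup>2)"
      using fin unfolding evariance_def ud(2)
      by (intro integrableI_nonneg) (auto simp: less_top)
    have sqp: "integrable (P p) (\<lambda>x. (?\<delta> x - \<tau> p)\<^sup>2)"
      by (rule integrable_square_add(2)) (auto simp: sq[OF p])
    have ab: "integrable (P p) (\<lambda>x. (?\<delta> x - \<tau> p) * (\<delta>' x - \<tau> p))"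
      by (rule integrable_square_add(1)) (auto simp: sqd sqp)
    have "integrable (P p) (\<lambda>x. (?\<delta> x - \<tau> p) * (\<delta>' x - \<tau> p) + \<tau> p * (?\<delta> x - \<tau> p))"
      using ab up by simp
    then have ad: "integrable (P p) (\<lambda>x. (?\<delta> x - \<tau> p) * \<delta>' x)" by (simp add: algebra_simps)
    have "integrable (P p) (\<lambda>x. (?\<delta> x - \<tau> p)\<^sup>2 + \<tau> p * (?\<delta> x - \<tau> p))"
      using sqp up by simp
    then have aa: "integrable (P p) (\<lambda>x. (?\<delta> x - \<tau> p) * ?\<delta> x)"
      by (simp add: algebra_simps power2_eq_square)
    \<comment> \<open>Rao-Blackwell: the same \<open>g\<close> represents the conditional
      expectation of \<open>\<delta>'\<close> under every parameter. Hence \<open>g - \<phi>\<close>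
      composed with \<open>S\<close> has mean zero throughout the model, and completeness identifies
      the two.\<close>
    obtain g where g[measurable]: "g \<in> borel_measurable Y"
      and gc: "\<forall>q\<in>\<Theta>. AE x in P q. real_cond_exp (P q) ?F \<delta>' x = g (S x)"
      using factorized_model_cond_exp[OF mod ud(3)] by blast
    have gi: "integrable (P q) (\<lambda>x. g (S x) - ?\<delta> x) \<and> (\<integral>x. g (S x) - ?\<delta> x \<partial>P q) = 0"
      if q: "q \<in> \<Theta>" for q
    proof -
      interpret Q: prob_space "P q" using mod q by (simp add: factorized_model_def)
      note setsq = factorized_model_sets[OF mod q]
      have spq: "space (P q) = space X" using setsq by (rule sets_eq_imp_space_eq)
      have SQ[measurable]: "S \<in> P q \<rightarrow>\<^sub>M Y" using S measurable_cong_sets[OF setsq refl] by blast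
      interpret Q: finite_measure_subalgebra "P q" ?F
        using vimage_algebra_finite_measure_subalgebra[OF Q.finite_measure_axioms SQ] by (simp add: spq)
      have dq: "integrable (P q) \<delta>'" "integral\<^sup>L (P q) \<delta>' = \<tau> q"
        "integrable (P q) ?\<delta>" "integral\<^sup>L (P q) ?\<delta> = \<tau> q"
        using u unb q by (auto simp: unbiased_estimator_def)
      have gq: "AE x in P q. real_cond_exp (P q) ?F \<delta>' x = g (S x)" using gc q by blast
      have 1: "integrable (P q) (\<lambda>x. g (S x))"
        by (rule integrable_cong_AE_imp[OF Q.real_cond_exp_int(1)[OF dq(1)] _ gq]) measurable
      have 2: "(\<integral>x. g (S x) \<partial>P q) = \<tau> q"
        using Q.real_cond_exp_int(2)[OF dq(1)] dq(2)
          integral_cong_AE[OF _ _ gq] by (auto simp: measurable_from_subalg[OF Q.subalg])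
      show ?thesis using 1 2 dq by simp
    qed
    have "AE x in P p. g (S x) - ?\<delta> x = 0"
      using com p gi unfolding complete_statistic_def
      by (elim conjE allE[of _ "\<lambda>y. g y - \<phi> y"]) auto
    with gc p have eq: "AE x in P p. real_cond_exp (P p) ?F \<delta>' x = ?\<delta> x" by force
    \<comment> \<open>The error \<open>?\<delta> x - \<tau> p\<close> is a function of
      \<open>S x\<close>, so \<open>\<delta>'\<close> may be replaced by its conditional
      expectation, which is \<open>?\<delta>\<close>. The cross term of the decomposition therefore
      vanishes.\<close>
    have "(\<integral>x. (?\<delta> x - \<tau> p) * \<delta>' x \<partial>P p) = (\<integral>x. (?\<delta> x - \<tau> p) * real_cond_exp (P p) ?F \<delta>' x \<partial>P p)"
      by (rule F.real_cond_exp_intg(2)[symmetric, OF ad]) measurable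
    also have "\<dots> = (\<integral>x. (?\<delta> x - \<tau> p) * ?\<delta> x \<partial>P p)"
    proof (rule integral_cong_AE)
      show "AE x in P p. (?\<delta> x - \<tau> p) * real_cond_exp (P p) ?F \<delta>' x = (?\<delta> x - \<tau> p) * ?\<delta> x"
        using eq by eventually_elim simp
    qed measurable
    finally have orth: "(\<integral>x. (?\<delta> x - \<tau> p) * (\<delta>' x - ?\<delta> x) \<partial>P p) = 0"
      using ad aa by (simp add: right_diff_distrib)
    have "integrable (P p) (\<lambda>x. ((\<delta>' x - \<tau> p) - (?\<delta> x - \<tau> p))\<^sup>2)"
      by (rule integrable_square_add(2)) (auto simp: sqd sqp)
    then show i': "integrable (P p) (\<lambda>x. (\<delta>' x - ?\<delta> x)\<^sup>2)" by simp
    have io: "integrable (P p) (\<lambda>x. (?\<delta> x - \<tau> p) * (\<delta>' x - ?\<delta> x))"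
      using ad aa by (simp add: right_diff_distrib)
    show var: "evariance (P p) ?\<delta> = ennreal (\<integral>x. (?\<delta> x - \<tau> p)\<^sup>2 \<partial>P p)"
      using evariance_eq_integral[of "P p" ?\<delta>] sqp up by simp
    have "(\<integral>x. (\<delta>' x - \<tau> p)\<^sup>2 \<partial>P p)
      = (\<integral>x. (?\<delta> x - \<tau> p)\<^sup>2 + 2 * ((?\<delta> x - \<tau> p) * (\<delta>' x - ?\<delta> x)) + (\<delta>' x - ?\<delta> x)\<^sup>2 \<partial>P p)"
      by (intro Bochner_Integration.integral_cong) (auto simp: power2_eq_square algebra_simps)
    also have "\<dots> = (\<integral>x. (?\<delta> x - \<tau> p)\<^sup>2 \<partial>P p) + (\<integral>x. (\<delta>' x - ?\<delta> x)\<^sup>2 \<partial>P p)"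
      using sqp io i' orth by simp
    finally show "evariance (P p) \<delta>' = evariance (P p) ?\<delta> + ennreal (\<integral>x. (\<delta>' x - ?\<delta> x)\<^sup>2 \<partial>P p)"
      using evariance_eq_integral[of "P p" \<delta>'] sqd ud var by (simp add: ennreal_plus)
  qed
  have um: "umvu_estimator X \<Theta> P \<tau> ?\<delta>"
    unfolding umvu_estimator_def
  proof (intro conjI unb allI impI ballI)
    fix \<delta>' p assume "unbiased_estimator X \<Theta> P \<tau> \<delta>'" "p \<in> \<Theta>"
    then show "evariance (P p) ?\<delta> \<le> evariance (P p) \<delta>'"
      using var'[of p \<delta>'] by (cases "evariance (P p) \<delta>' = \<infinity>") auto
  qed
  show ?thesis
    unfolding the_umvu_estimator_def
  proof (intro conjI um allI impI ballI)
    fix \<delta>' p assume d: "umvu_estimator X \<Theta> P \<tau> \<delta>'" and p: "p \<in> \<Theta>"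
    then have u: "unbiased_estimator X \<Theta> P \<tau> \<delta>'"
      and le: "evariance (P p) \<delta>' \<le> evariance (P p) ?\<delta>"
      using unb by (auto simp: umvu_estimator_def)
    have "evariance (P p) ?\<delta> \<noteq> \<infinity>"
    proof -
      interpret prob_space "P p" using mod p by (simp add: factorized_model_def)
      have up: "integrable (P p) ?\<delta>" "integral\<^sup>L (P p) ?\<delta> = \<tau> p"
        using unb p by (auto simp: unbiased_estimator_def)
      have [measurable]: "?\<delta> \<in> borel_measurable (P p)" using up(1) by simp
      have "integrable (P p) (\<lambda>x. (?\<delta> x - \<tau> p)\<^sup>2)"
        by (rule integrable_square_add(2)) (auto simp: sq[OF p])
      then show ?thesis using evariance_eq_integral[of "P p" ?\<delta>] up by simp
    qed
    with le have fin: "evariance (P p) \<delta>' \<noteq> \<infinity>" by (auto simp: top_unique)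
    note v = var[OF p u fin] var'[OF p u fin] i'[OF p u fin]
    have "(\<integral>x. (\<delta>' x - ?\<delta> x)\<^sup>2 \<partial>P p) \<le> 0"
      using le unfolding v(2) v(1)
      by (simp add: ennreal_plus[symmetric] ennreal_le_iff del: ennreal_plus)
    moreover have "0 \<le> (\<integral>x. (\<delta>' x - ?\<delta> x)\<^sup>2 \<partial>P p)" by simp
    ultimately have "(\<integral>x. (\<delta>' x - ?\<delta> x)\<^sup>2 \<partial>P p) = 0" by linarith
    then have "AE x in P p. (\<delta>' x - ?\<delta> x)\<^sup>2 = 0"
      using integral_nonneg_eq_0_iff_AE[OF v(3)] by simp
    then show "AE x in P p. \<delta>' x = ?\<delta> x" by eventually_elim simp
  qed
qed

section \<open>Bounded random vectors are determined by their moments\<close>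

lemma integrable_mult_continuous_bounded:
  fixes G :: "'a \<Rightarrow> real" and W :: "'a \<Rightarrow> 'b::euclidean_space" and c :: "'b \<Rightarrow> real"
  assumes G: "integrable M G" and W: "W \<in> borel_measurable M"
    and K: "compact K" "\<And>x. W x \<in> K" and c: "continuous_on UNIV c"
  shows "integrable M (\<lambda>x. G x * c (W x))"
proof -
  note [measurable] = W borel_measurable_continuous_onI[OF c]
  have [measurable]: "G \<in> borel_measurable M" using G by simp
  have "bounded (c ` K)"
    using K c by (intro compact_imp_bounded compact_continuous_image)
      (auto intro: continuous_on_subset)
  then obtain B where B: "\<And>w. w \<in> K \<Longrightarrow> \<bar>c w\<bar> \<le> B"
    unfolding bounded_iff by auto
  show ?thesis
  proof (rule Bochner_Integration.integrable_bound)
    show "integrable M (\<lambda>x. B * G x)" using G by simp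
    have "norm (G x * c (W x)) \<le> norm (B * G x)" for x
      using mult_right_mono[OF B[OF K(2)[of x]], of "\<bar>G x\<bar>"] B[OF K(2)[of x]]
      by (auto simp: abs_mult ac_simps)
    then show "AE x in M. norm (G x * c (W x)) \<le> norm (B * G x)" by simp
  qed measurable
qed

text \<open>The induction hypothesis quantifies over a second factor \<open>r\<close>, which makes the statement
  closed under products of polynomials.\<close>

lemma integral_mult_polynomial_eq_0:
  fixes G :: "'a \<Rightarrow> real" and W :: "'a \<Rightarrow> real \<times> real"
  assumes G: "integrable M G" and W: "W \<in> borel_measurable M"
    and K: "compact K" "\<And>x. W x \<in> K"
    and mom: "\<And>i j. (\<integral>x. G x * (fst (W x) ^ i * snd (W x) ^ j) \<partial>M) = 0"
    and q: "real_polynomial_function q"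
  shows "(\<integral>x. G x * q (W x) \<partial>M) = 0"
proof -
  define good where "good r \<longleftrightarrow> continuous_on UNIV r \<and>
    (\<forall>i j. (\<integral>x. G x * (r (W x) * (fst (W x) ^ i * snd (W x) ^ j)) \<partial>M) = 0)"
    for r :: "real \<times> real \<Rightarrow> real"
  have int: "integrable M (\<lambda>x. G x * c (W x))" if "continuous_on UNIV c" for c
    by (rule integrable_mult_continuous_bounded[OF G W K that])
  have intm: "integrable M (\<lambda>x. G x * (c (W x) * (fst (W x) ^ i * snd (W x) ^ j)))"
    if "continuous_on UNIV c" for c i j
    by (rule int[of "\<lambda>w. c w * (fst w ^ i * snd w ^ j)"]) (intro continuous_intros that)
  have "\<forall>r. good r \<longrightarrow> good (\<lambda>w. q w * r w)"
    using q
  proof (induction rule: real_polynomial_function.induct)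
    case (linear f)
    interpret f: bounded_linear f by fact
    have f: "f w = f (1,0) * fst w + f (0,1) * snd w" for w
    proof -
      have "w = fst w *\<^sub>R (1,0) + snd w *\<^sub>R (0,1)" by (cases w) auto
      then have "f w = f (fst w *\<^sub>R (1,0) + snd w *\<^sub>R (0,1))" by simp
      then show ?thesis by (simp only: f.add f.scaleR) (simp add: mult.commute)
    qed
    show ?case
    proof (intro allI impI)
      fix r assume r: "good r"
      then have cr: "continuous_on UNIV r" by (simp add: good_def)
      have "(\<integral>x. G x * (f (W x) * r (W x) * (fst (W x) ^ i * snd (W x) ^ j)) \<partial>M)
        = (\<integral>x. f (1,0) * (G x * (r (W x) * (fst (W x) ^ Suc i * snd (W x) ^ j)))
            + f (0,1) * (G x * (r (W x) * (fst (W x) ^ i * snd (W x) ^ Suc j))) \<partial>M)" for i j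
        by (intro Bochner_Integration.integral_cong refl, subst f) (simp add: algebra_simps)
      also have "\<dots> i j = 0" for i j
        using r intm[OF cr, of "Suc i" j] intm[OF cr, of i "Suc j"]
        by (subst Bochner_Integration.integral_add) (auto simp: good_def simp del: power_Suc)
      finally show "good (\<lambda>w. f w * r w)"
        using cr linear_continuous_on[OF f.bounded_linear_axioms]
        by (auto simp: good_def intro!: continuous_on_mult)
    qed
  next
    case (const c)
    then show ?case by (auto simp: good_def mult.assoc mult.left_commute[of _ c] intro!: continuous_intros)
  next
    case (add f g)
    show ?case
    proof (intro allI impI)
      fix r assume "good r"
      then have f: "good (\<lambda>w. f w * r w)" and g: "good (\<lambda>w. g w * r w)" using add by auto
      then have c: "continuous_on UNIV (\<lambda>w. f w * r w)" "continuous_on UNIV (\<lambda>w. g w * r w)"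
        by (auto simp: good_def)
      have "(\<integral>x. G x * ((f (W x) + g (W x)) * r (W x) * (fst (W x) ^ i * snd (W x) ^ j)) \<partial>M)
        = (\<integral>x. G x * (f (W x) * r (W x) * (fst (W x) ^ i * snd (W x) ^ j))
             + G x * (g (W x) * r (W x) * (fst (W x) ^ i * snd (W x) ^ j)) \<partial>M)" for i j
        by (intro Bochner_Integration.integral_cong) (auto simp: algebra_simps)
      also have "\<dots> i j = 0" for i j
        using f g intm[OF c(1), of i j] intm[OF c(2), of i j] by (simp add: good_def)
      finally show "good (\<lambda>w. (f w + g w) * r w)"
        using continuous_on_add[OF c] by (auto simp: good_def distrib_right)
    qed
  next
    case (mult f g)
    then show ?case by (simp add: mult.assoc)
  qed
  moreover have "good (\<lambda>w. 1)" using mom by (simp add: good_def)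
  ultimately have "good (\<lambda>w. q w * 1)" by blast
  then have "(\<integral>x. G x * (q (W x) * 1 * (fst (W x) ^ 0 * snd (W x) ^ 0)) \<partial>M) = 0"
    unfolding good_def by blast
  then show ?thesis by simp
qed

text \<open>Continuous functions equal to 1 on \<open>C\<close> and decaying linearly with the
  distance, ever more steeply. The empty set must be excluded: \<open>infdist x {}\<close> is 0, so
  the limit would be 1.\<close>

lemma closed_indicator_limit:
  fixes C :: "'a::metric_space set"
  assumes "closed C" "C \<noteq> {}"
  shows "(\<lambda>n. max 0 (1 - real n * infdist x C)) \<longlonglongrightarrow> indicator C x"
proof (cases "x \<in> C")
  case True
  then show ?thesis by simp
next
  case False
  then have pos: "infdist x C > 0" using assms infdist_pos_not_in_closed by blast
  obtain n0 :: nat where n0: "1 / infdist x C < real n0" using reals_Archimedean2 by blast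
  have "max 0 (1 - real n * infdist x C) = 0" if "n \<ge> n0" for n
  proof -
    have "1 / infdist x C < real n" using n0 that by linarith
    then show ?thesis using pos by (simp add: divide_less_eq)
  qed
  then have "eventually (\<lambda>n. max 0 (1 - real n * infdist x C) = indicator C x) sequentially"
    using False by (auto simp: eventually_sequentially)
  then show ?thesis by (rule tendsto_eventually)
qed

text \<open>Stone--Weierstrass passes from polynomials to continuous functions, and the closed sets
  generate the Borel sets.\<close>

lemma AE_eq_0_of_moments_eq_0:
  fixes G :: "'a \<Rightarrow> real" and W :: "'a \<Rightarrow> real \<times> real" and \<gamma> :: "real \<times> real \<Rightarrow> real"
  assumes G: "integrable M G" and W[measurable]: "W \<in> borel_measurable M"
    and K: "compact K" "\<And>x. W x \<in> K"
    and mom: "\<And>i j. (\<integral>x. G x * (fst (W x) ^ i * snd (W x) ^ j) \<partial>M) = 0"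
    and gam[measurable]: "\<gamma> \<in> borel_measurable borel" and Gg: "\<And>x. x \<in> space M \<Longrightarrow> G x = \<gamma> (W x)"
  shows "AE x in M. G x = 0"
proof -
  have [measurable]: "G \<in> borel_measurable M" using G by simp
  have poly: "(\<integral>x. G x * q (W x) \<partial>M) = 0" if "real_polynomial_function q" for q
    by (rule integral_mult_polynomial_eq_0[OF G W K mom that])
  have cont: "(\<integral>x. G x * c (W x) \<partial>M) = 0" if c: "continuous_on UNIV c" for c :: "real \<times> real \<Rightarrow> real"
  proof -
    have "\<bar>\<integral>x. G x * c (W x) \<partial>M\<bar> \<le> 0 + e" if e: "e > 0" for e
    proof -
      \<comment> \<open>An approximation error \<open>e'\<close> on \<open>K\<close> costs at most
        \<open>e'\<close> times the \<open>L1\<close> norm of \<open>G\<close>, hence at most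
        \<open>e\<close>; the added 1 keeps the divisor positive when that norm is zero.\<close>
      define e' where "e' = e / ((\<integral>x. \<bar>G x\<bar> \<partial>M) + 1)"
      have n: "(\<integral>x. \<bar>G x\<bar> \<partial>M) \<ge> 0" by simp
      then have e': "e' > 0" using e add_nonneg_pos[OF n zero_less_one] unfolding e'_def by (intro divide_pos_pos)
      obtain q where q: "real_polynomial_function q" "\<And>w. w \<in> K \<Longrightarrow> \<bar>c w - q w\<bar> < e'"
        using Stone_Weierstrass_real_polynomial_function[OF K(1) _ e', of c] c
          continuous_on_subset by blast
      have cq: "continuous_on UNIV q" using q(1)
        by (simp add: continuous_on_polymonial_function real_polynomial_function_eq)
      have i: "integrable M (\<lambda>x. G x * c (W x))" "integrable M (\<lambda>x. G x * q (W x))"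
        using integrable_mult_continuous_bounded[OF G W K] c cq by auto
      have "\<bar>\<integral>x. G x * c (W x) \<partial>M\<bar> = \<bar>\<integral>x. G x * c (W x) - G x * q (W x) \<partial>M\<bar>"
        using i poly[OF q(1)] by simp
      also have "\<dots> \<le> (\<integral>x. \<bar>G x * c (W x) - G x * q (W x)\<bar> \<partial>M)"
        by (rule integral_abs_bound)
      also have "\<dots> \<le> (\<integral>x. e' * \<bar>G x\<bar> \<partial>M)"
      proof (rule integral_mono)
        fix x
        have "\<bar>G x * c (W x) - G x * q (W x)\<bar> = \<bar>G x\<bar> * \<bar>c (W x) - q (W x)\<bar>"
          by (simp add: abs_mult flip: right_diff_distrib)
        also have "\<dots> \<le> \<bar>G x\<bar> * e'"
          by (intro mult_left_mono less_imp_le[OF q(2)] K) auto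
        finally show "\<bar>G x * c (W x) - G x * q (W x)\<bar> \<le> e' * \<bar>G x\<bar>" by (simp add: mult.commute)
      qed (use i G in auto)
      also have "\<dots> = e * ((\<integral>x. \<bar>G x\<bar> \<partial>M) / ((\<integral>x. \<bar>G x\<bar> \<partial>M) + 1))" by (simp add: e'_def)
      also have "\<dots> \<le> e * 1" using e add_nonneg_pos[OF n zero_less_one]
        by (intro mult_left_mono) (auto simp: divide_le_eq)
      finally show ?thesis by simp
    qed
    then show ?thesis using field_le_epsilon[of "\<bar>\<integral>x. G x * c (W x) \<partial>M\<bar>" 0] by simp
  qed
  have closed: "(\<integral>x. G x * indicator C (W x) \<partial>M) = 0" if C: "closed C" for C :: "(real \<times> real) set"
  proof (cases "C = {}")
    case False
    let ?f = "\<lambda>n w. max 0 (1 - real n * infdist w C)"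
    have cf: "continuous_on UNIV (?f n)" for n by (intro continuous_intros)
    have [measurable]: "C \<in> sets borel" "?f n \<in> borel_measurable borel" for n
      using C borel_measurable_continuous_onI[OF cf] by auto
    have "(\<lambda>n. \<integral>x. G x * ?f n (W x) \<partial>M) \<longlonglongrightarrow> (\<integral>x. G x * indicator C (W x) \<partial>M)"
    proof (rule integral_dominated_convergence[where w="\<lambda>x. \<bar>G x\<bar>"])
      show "AE x in M. (\<lambda>n. G x * ?f n (W x)) \<longlonglongrightarrow> G x * indicator C (W x)"
        by (intro AE_I2 tendsto_mult_left closed_indicator_limit C False)
      have "norm (G x * ?f n (W x)) \<le> \<bar>G x\<bar>" for n x
      proof -
        have "\<bar>?f n (W x)\<bar> \<le> 1" by (auto simp: infdist_nonneg)
        then show ?thesis using mult_left_mono[of "\<bar>?f n (W x)\<bar>" 1 "\<bar>G x\<bar>"] by (simp add: abs_mult)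
      qed
      then show "AE x in M. norm (G x * ?f n (W x)) \<le> \<bar>G x\<bar>" for n by simp
    qed (use G in auto)
    then show ?thesis using cont[OF cf] by (simp add: LIMSEQ_const_iff)
  qed simp
  \<comment> \<open>Since \<open>G\<close> is signed, the Dynkin argument is run on the integral
    itself, with the intersection-stable closed sets as generator.\<close>
  have sets: "(\<integral>x. G x * indicator A (W x) \<partial>M) = 0" if "A \<in> sets borel" for A :: "(real \<times> real) set"
  proof -
    have ii: "integrable M (\<lambda>x. G x * indicator A (W x))" if "A \<in> sets borel" for A :: "(real \<times> real) set"
    proof -
      have [measurable]: "A \<in> sets borel" by fact
      show ?thesis
        by (rule Bochner_Integration.integrable_bound[OF G]) (auto simp: indicator_def)
    qed
    have bs: "sets borel = sigma_sets UNIV (Collect (closed :: (real \<times> real) set \<Rightarrow> bool))"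
      by (subst borel_eq_closed) (rule sets_measure_of, simp)
    have "Int_stable (Collect (closed :: (real \<times> real) set \<Rightarrow> bool))"
      by (auto simp: Int_stable_def)
    moreover have "Collect closed \<subseteq> Pow (UNIV :: (real \<times> real) set)" by simp
    moreover have "A \<in> sigma_sets UNIV (Collect closed)" using that bs by simp
    ultimately show ?thesis
    proof (induction rule: sigma_sets_induct_disjoint)
      case (basic A)
      then show ?case using closed by simp
    next
      case empty
      show ?case by simp
    next
      case (compl A)
      then have A: "A \<in> sets borel" using bs by simp
      have "(\<integral>x. G x * indicator (UNIV - A) (W x) \<partial>M) = (\<integral>x. G x * indicator UNIV (W x) - G x * indicator A (W x) \<partial>M)"
        by (intro Bochner_Integration.integral_cong) (auto simp: indicator_def)
      also have "\<dots> = 0"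
        using compl ii[OF A] ii[of UNIV] closed[of UNIV] by (subst Bochner_Integration.integral_diff) auto
      finally show ?case .
    next
      case (union A)
      then have A[measurable]: "A i \<in> sets borel" for i using bs by auto
      let ?B = "\<lambda>i. W -` A i \<inter> space M"
      have B: "?B i \<in> sets M" for i by measurable
      have eq: "(\<integral>x\<in>W -` C \<inter> space M. G x \<partial>M) = (\<integral>x. G x * indicator C (W x) \<partial>M)" for C
        unfolding set_lebesgue_integral_def
        by (intro Bochner_Integration.integral_cong) (auto simp: indicator_def)
      have "(\<integral>x\<in>(\<Union>i. ?B i). G x \<partial>M) = (\<Sum>i. \<integral>x\<in>?B i. G x \<partial>M)"
      proof (rule lebesgue_integral_countable_add[OF B])
        show "?B i \<inter> ?B j = {}" if "i \<noteq> j" for i j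
        proof -
          have "A i \<inter> A j = {}" using union(1) that by (auto simp: disjoint_family_on_def)
          then show ?thesis by blast
        qed
        show "set_integrable M (\<Union>i. ?B i) G"
          unfolding set_integrable_def using G by (intro integrable_mult_indicator) auto
      qed
      also have "(\<Union>i. ?B i) = W -` (\<Union>i. A i) \<inter> space M" by auto
      finally show ?case using union(3) by (simp add: eq)
    qed
  qed
  \<comment> \<open>Because \<open>G\<close> is \<open>\<gamma>\<close> after \<open>W\<close>, the
    sets where \<open>G\<close> is positive or negative are preimages of Borel sets under
    \<open>W\<close>; both parts of \<open>G\<close> thus integrate to zero.\<close>
  have [measurable]: "{w. \<gamma> w > 0} \<in> sets borel" "{w. \<gamma> w < 0} \<in> sets borel" by measurable
  have "(\<integral>x. max 0 (G x) \<partial>M) = (\<integral>x. G x * indicator {w. \<gamma> w > 0} (W x) \<partial>M)"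
    "(\<integral>x. max 0 (- G x) \<partial>M) = (\<integral>x. - (G x * indicator {w. \<gamma> w < 0} (W x)) \<partial>M)"
    by (intro Bochner_Integration.integral_cong refl; auto simp: Gg indicator_def max_def)+
  then have z: "(\<integral>x. max 0 (G x) \<partial>M) = 0" "(\<integral>x. max 0 (- G x) \<partial>M) = 0"
    by (simp_all add: sets)
  have i: "integrable M (\<lambda>x. max 0 (G x))" "integrable M (\<lambda>x. max 0 (- G x))" using G by auto
  have "AE x in M. max 0 (G x) = 0" "AE x in M. max 0 (- G x) = 0"
    using z integral_nonneg_eq_0_iff_AE[OF i(1)] integral_nonneg_eq_0_iff_AE[OF i(2)] by auto
  then show ?thesis by eventually_elim (auto simp: max_def split: if_splits)
qed

section \<open>Positive definiteness of the fractional Brownian covariance\<close>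

text \<open>The spectral density of fractional Brownian motion up to a constant, restricted to
  positive frequencies.\<close>

definition fbm_spectral_weight :: "real \<Rightarrow> real \<Rightarrow> real" where
  "fbm_spectral_weight H x = (if x > 0 then x powr (- 1 - 2 * H) else 0)"

lemma fbm_spectral_weight_nonneg: "0 \<le> fbm_spectral_weight H x"
  by (simp add: fbm_spectral_weight_def)

lemma fbm_spectral_weight_measurable [measurable]:
  "fbm_spectral_weight H \<in> borel_measurable borel"
  unfolding fbm_spectral_weight_def[abs_def] by measurable

lemma one_minus_cos_le: "1 - cos x \<le> x\<^sup>2 / (2::real)"
proof -
  have "cos x = 1 - 2 * (sin (x / 2))\<^sup>2" using cos_double_sin[of "x / 2"] by simp
  moreover have "(sin (x / 2))\<^sup>2 \<le> (x / 2)\<^sup>2"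
    using abs_sin_x_le_abs_x[of "x / 2"] by (rule abs_le_square_iff[THEN iffD1])
  ultimately show ?thesis by (simp add: power_divide)
qed

text \<open>Near zero \<open>1 - cos (t * x)\<close> is quadratic and leaves
  \<open>x powr (1 - 2 * H)\<close>, integrable because \<open>H < 1\<close>; at infinity it is
  bounded by 2 and \<open>x powr (- 1 - 2 * H)\<close> is integrable because
  \<open>0 < H\<close>.\<close>

lemma integrable_fbm_spectral:
  assumes H: "0 < H" "H < 1"
  shows "integrable lborel (\<lambda>x. fbm_spectral_weight H x * (1 - cos (t * x)))"
proof -
  have "(\<integral>\<^sup>+x. ennreal (indicator {0..1} x * x powr (1 - 2 * H)) \<partial>lborel) < \<infinity>"
    using nn_integral_has_integral_lebesgue[OF _ has_integral_powr_from_0[of "1 - 2 * H" 1]] H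
    by auto
  then have 1: "integrable lborel (\<lambda>x. indicator {0..1} x * x powr (1 - 2 * H))"
    by (intro integrableI_nonneg) auto
  have "(\<integral>\<^sup>+x. ennreal (indicator {1..} x * x powr (- 1 - 2 * H)) \<partial>lborel) < \<infinity>"
    using nn_integral_has_integral_lebesgue[OF _ has_integral_powr_to_inf[of "- 1 - 2 * H" 1]] H
    by auto
  then have 2: "integrable lborel (\<lambda>x. indicator {1..} x * x powr (- 1 - 2 * H))"
    by (intro integrableI_nonneg) auto
  show ?thesis
  proof (rule Bochner_Integration.integrable_bound)
    show "integrable lborel (\<lambda>x. t\<^sup>2 / 2 * (indicator {0..1} x * x powr (1 - 2 * H))
        + 2 * (indicator {1..} x * x powr (- 1 - 2 * H)))"
      using 1 2 by simp
    have "fbm_spectral_weight H x * (1 - cos (t * x)) \<le> t\<^sup>2 / 2 * (indicator {0..1} x * x powr (1 - 2 * H))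
        + 2 * (indicator {1..} x * x powr (- 1 - 2 * H))" for x
    proof -
      consider "x \<le> 0" | "0 < x" "x \<le> 1" | "1 < x" by linarith
      then show ?thesis
      proof cases
        case 1
        then show ?thesis by (simp add: fbm_spectral_weight_def)
      next
        case 2
        have "x powr (- 1 - 2 * H) * (1 - cos (t * x)) \<le> x powr (- 1 - 2 * H) * ((t * x)\<^sup>2 / 2)"
          by (intro mult_left_mono one_minus_cos_le) auto
        also have "\<dots> = t\<^sup>2 / 2 * (x powr (- 1 - 2 * H) * x powr 2)"
          using 2 by (simp add: power_mult_distrib)
        also have "\<dots> = t\<^sup>2 / 2 * x powr (1 - 2 * H)"
          by (simp flip: powr_add)
        finally show ?thesis using 2 by (auto simp: fbm_spectral_weight_def indicator_def)
      next
        case 3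
        have "x powr (- 1 - 2 * H) * (1 - cos (t * x)) \<le> x powr (- 1 - 2 * H) * 2"
          using cos_ge_minus_one[of "t * x"] by (intro mult_left_mono) auto
        then show ?thesis using 3 by (auto simp: fbm_spectral_weight_def indicator_def)
      qed
    qed
    then show "AE x in lborel. norm (fbm_spectral_weight H x * (1 - cos (t * x)))
       \<le> norm (t\<^sup>2 / 2 * (indicator {0..1} x * x powr (1 - 2 * H))
        + 2 * (indicator {1..} x * x powr (- 1 - 2 * H)))"
      using fbm_spectral_weight_nonneg by (intro AE_I2) (auto simp: abs_mult)
  qed measurable
qed

text \<open>Scaling of the power weight under the substitution of \<open>\<bar>t\<bar> * x\<close>
  for \<open>x\<close>. At \<open>t = 0\<close> both sides are zero, as
  \<open>0 powr (2 * H) = 0\<close>.\<close>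

lemma integral_fbm_spectral:
  "(\<integral>x. fbm_spectral_weight H x * (1 - cos (t * x)) \<partial>lborel)
    = \<bar>t\<bar> powr (2 * H) * (\<integral>x. fbm_spectral_weight H x * (1 - cos x) \<partial>lborel)"
proof (cases "t = 0")
  case False
  then have pos: "\<bar>t\<bar> > 0" by simp
  have "(\<integral>x. fbm_spectral_weight H x * (1 - cos x) \<partial>lborel)
     = \<bar>t\<bar> * (\<integral>x. fbm_spectral_weight H (\<bar>t\<bar> * x) * (1 - cos (\<bar>t\<bar> * x)) \<partial>lborel)"
    using lborel_integral_real_affine[of "\<bar>t\<bar>" "\<lambda>x. fbm_spectral_weight H x * (1 - cos x)" 0] pos by simp
  also have "\<dots> = \<bar>t\<bar> * (\<integral>x. \<bar>t\<bar> powr (- 1 - 2 * H) * (fbm_spectral_weight H x * (1 - cos (t * x))) \<partial>lborel)"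
  proof (intro arg_cong[where f="\<lambda>u. \<bar>t\<bar> * u"] Bochner_Integration.integral_cong refl)
    fix x
    have "cos (\<bar>t\<bar> * x) = cos (t * x)" by (cases "t \<ge> 0") auto
    then show "fbm_spectral_weight H (\<bar>t\<bar> * x) * (1 - cos (\<bar>t\<bar> * x))
      = \<bar>t\<bar> powr (- 1 - 2 * H) * (fbm_spectral_weight H x * (1 - cos (t * x)))"
      using pos by (auto simp: fbm_spectral_weight_def powr_mult zero_less_mult_iff)
  qed
  also have "\<dots> = (\<bar>t\<bar> powr 1 * \<bar>t\<bar> powr (- 1 - 2 * H)) * (\<integral>x. fbm_spectral_weight H x * (1 - cos (t * x)) \<partial>lborel)"
    using pos by simp
  also have "\<bar>t\<bar> powr 1 * \<bar>t\<bar> powr (- 1 - 2 * H) = \<bar>t\<bar> powr (- (2 * H))"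
    by (subst powr_add[symmetric]) simp
  finally show ?thesis using pos by (simp add: powr_minus field_simps)
qed simp

text \<open>A finite exceptional set would be null, unlike the interval. Infinitely many points are
  all that is needed to contradict the finiteness of the roots of a polynomial.\<close>

lemma AE_lborel_infinite:
  fixes a b :: real
  assumes "AE x in lborel. P x" "a < b"
  shows "infinite {x\<in>{a<..<b}. P x}"
proof
  assume fin: "finite {x\<in>{a<..<b}. P x}"
  have "AE x in lborel. x \<notin> {x\<in>{a<..<b}. P x}"
    by (intro AE_not_in finite_imp_null_set_lborel fin)
  with assms(1) have "AE x in lborel. x \<notin> {a<..<b}"
    by eventually_elim auto
  then have "{a<..<b} \<in> null_sets lborel" by (subst (asm) AE_iff_null_sets[symmetric]) auto
  then show False using assms(2) by (simp add: null_sets_def)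
qed

lemma fbm_spectral_constant_pos:
  assumes H: "0 < H" "H < 1"
  shows "0 < (\<integral>x. fbm_spectral_weight H x * (1 - cos x) \<partial>lborel)"
proof -
  let ?f = "\<lambda>x. fbm_spectral_weight H x * (1 - cos x)"
  have i: "integrable lborel ?f" using integrable_fbm_spectral[OF H, of 1] by simp
  have nn: "AE x in lborel. 0 \<le> ?f x" by (simp add: fbm_spectral_weight_nonneg)
  have "integral\<^sup>L lborel ?f \<noteq> 0"
  proof
    assume "integral\<^sup>L lborel ?f = 0"
    then have "AE x in lborel. ?f x = 0"
      using integral_nonneg_eq_0_iff_AE[OF i nn] by simp
    then have "infinite {x\<in>{0<..<1}. ?f x = 0}" by (rule AE_lborel_infinite) simp
    then obtain x where x: "0 < x" "x < 1" "?f x = 0" by (auto dest: infinite_imp_nonempty)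
    then have "cos x = cos 0" by (auto simp: fbm_spectral_weight_def)
    then show False using cos_inj_pi[of x 0] x pi_gt3 by auto
  qed
  moreover have "0 \<le> integral\<^sup>L lborel ?f" using nn by (rule integral_nonneg_AE)
  ultimately show ?thesis by linarith
qed

text \<open>The spectral representation \<open>|t| powr (2 * H) = c * (\<integral>x>0. (1 - cos (t * x)) * x powr (- 1 - 2 * H))\<close>
  turns the quadratic form into the integral of the squared modulus of
  \<open>\<Sum>i. a i * (cis (t i * x) - 1)\<close>, a polynomial in \<open>cis (h * x)\<close> on an equidistant grid.\<close>

lemma fbm_cov_quadratic_form:
  fixes a t :: "'n::finite \<Rightarrow> real"
  assumes H: "0 < H" "H < 1" and t: "\<And>i. 0 \<le> t i"
  defines "f \<equiv> \<lambda>x. fbm_spectral_weight H x * (cmod (\<Sum>i\<in>UNIV. a i * (cis (t i * x) - 1)))\<^sup>2"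
  shows "integrable lborel f"
    and "2 * (\<integral>x. fbm_spectral_weight H x * (1 - cos x) \<partial>lborel)
      * (\<Sum>i\<in>UNIV. \<Sum>j\<in>UNIV. a i * a j * fbm_cov H (t i) (t j)) = integral\<^sup>L lborel f"
proof -
  let ?w = "fbm_spectral_weight H"
  let ?c = "\<lambda>s x. ?w x * (1 - cos (s * x))"
  have i: "integrable lborel (?c s)" for s by (rule integrable_fbm_spectral[OF H])
  have sq: "(cmod (\<Sum>i\<in>UNIV. a i * (cis (t i * x) - 1)))\<^sup>2
    = (\<Sum>i\<in>UNIV. \<Sum>j\<in>UNIV. a i * a j *
        ((1 - cos (t i * x)) + (1 - cos (t j * x)) - (1 - cos ((t i - t j) * x))))" for x
  proof -
    have "(cmod (\<Sum>i\<in>UNIV. a i * (cis (t i * x) - 1)))\<^sup>2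
      = (\<Sum>i\<in>UNIV. a i * (cos (t i * x) - 1))\<^sup>2 + (\<Sum>i\<in>UNIV. a i * sin (t i * x))\<^sup>2"
      by (simp add: cmod_power2)
    also have "\<dots> = (\<Sum>i\<in>UNIV. \<Sum>j\<in>UNIV. a i * (cos (t i * x) - 1) * (a j * (cos (t j * x) - 1))
        + a i * sin (t i * x) * (a j * sin (t j * x)))"
      by (simp add: power2_eq_square sum_product sum.distrib)
    also have "\<dots> = (\<Sum>i\<in>UNIV. \<Sum>j\<in>UNIV. a i * a j *
        ((1 - cos (t i * x)) + (1 - cos (t j * x)) - (1 - cos ((t i - t j) * x))))"
      by (intro sum.cong refl) (simp add: left_diff_distrib cos_diff algebra_simps)
    finally show ?thesis .
  qed
  have f: "f = (\<lambda>x. \<Sum>i\<in>UNIV. \<Sum>j\<in>UNIV. a i * a j * (?c (t i) x + ?c (t j) x - ?c (t i - t j) x))"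
    unfolding f_def sq sum_distrib_left
    by (intro ext sum.cong refl) (simp add: algebra_simps)
  show "integrable lborel f"
    unfolding f
    by (intro Bochner_Integration.integrable_sum Bochner_Integration.integrable_mult_right
        Bochner_Integration.integrable_diff Bochner_Integration.integrable_add i)
  have "integral\<^sup>L lborel f = (\<Sum>i\<in>UNIV. \<Sum>j\<in>UNIV. a i * a j *
      (integral\<^sup>L lborel (?c (t i)) + integral\<^sup>L lborel (?c (t j)) - integral\<^sup>L lborel (?c (t i - t j))))"
    unfolding f
    by (simp add: i Bochner_Integration.integral_sum Bochner_Integration.integral_diff
        Bochner_Integration.integral_add Bochner_Integration.integrable_diff
        Bochner_Integration.integrable_add Bochner_Integration.integrable_sum)
  also have "\<dots> = 2 * (\<integral>x. ?w x * (1 - cos x) \<partial>lborel)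
      * (\<Sum>i\<in>UNIV. \<Sum>j\<in>UNIV. a i * a j * fbm_cov H (t i) (t j))"
    unfolding sum_distrib_left integral_fbm_spectral fbm_cov_def
    using t by (intro sum.cong refl) (simp add: algebra_simps)
  finally show "2 * (\<integral>x. ?w x * (1 - cos x) \<partial>lborel)
      * (\<Sum>i\<in>UNIV. \<Sum>j\<in>UNIV. a i * a j * fbm_cov H (t i) (t j)) = integral\<^sup>L lborel f" by simp
qed

lemma fbm_cov_quadratic_form_pos:
  fixes a :: "'n::finite \<Rightarrow> real" and k :: "'n \<Rightarrow> nat"
  assumes H: "0 < H" "H < 1" and h: "0 < h" and k: "inj k" "\<And>i. 0 < k i" and a: "a i0 \<noteq> 0"
  shows "0 < (\<Sum>i\<in>UNIV. \<Sum>j\<in>UNIV. a i * a j * fbm_cov H (real (k i) * h) (real (k j) * h))"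
proof -
  let ?t = "\<lambda>i. real (k i) * h"
  let ?Q = "\<Sum>i\<in>UNIV. \<Sum>j\<in>UNIV. a i * a j * fbm_cov H (?t i) (?t j)"
  let ?c = "\<integral>x. fbm_spectral_weight H x * (1 - cos x) \<partial>lborel"
  let ?f = "\<lambda>x. fbm_spectral_weight H x * (cmod (\<Sum>i\<in>UNIV. a i * (cis (?t i * x) - 1)))\<^sup>2"
  have t: "0 \<le> ?t i" for i using h by simp
  note i = fbm_cov_quadratic_form(1)[where t="?t" and a=a, OF H t]
  note Q = fbm_cov_quadratic_form(2)[where t="?t" and a=a, OF H t]
  have c: "0 < ?c" by (rule fbm_spectral_constant_pos[OF H])
  have nn: "AE x in lborel. 0 \<le> ?f x" by (simp add: fbm_spectral_weight_nonneg)
  have "integral\<^sup>L lborel ?f \<noteq> 0"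
  proof
    assume "integral\<^sup>L lborel ?f = 0"
    then have "AE x in lborel. ?f x = 0"
      using integral_nonneg_eq_0_iff_AE[OF i nn] by simp
    \<comment> \<open>On this interval \<open>h * x\<close> lies between 0 and 1, hence inside
      \<open>[0, pi]\<close> where \<open>cos\<close> is injective, so distinct frequencies give
      distinct roots \<open>cis (h * x)\<close>.\<close>
    then have inf: "infinite {x\<in>{0<..<1/h}. ?f x = 0}" by (rule AE_lborel_infinite) (use h in simp)
    define p :: "complex poly" where
      "p = (\<Sum>i\<in>UNIV. monom (of_real (a i)) (k i)) - [:\<Sum>i\<in>UNIV. of_real (a i):]"
    have inj: "inj_on (\<lambda>x. cis (h * x)) {x\<in>{0<..<1/h}. ?f x = 0}"
    proof (rule inj_onI)
      fix x y assume "x \<in> {x\<in>{0<..<1/h}. ?f x = 0}" "y \<in> {x\<in>{0<..<1/h}. ?f x = 0}"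
        and eq: "cis (h * x) = cis (h * y)"
      then have "0 \<le> h * x" "h * x \<le> pi" "0 \<le> h * y" "h * y \<le> pi"
        using h pi_gt3 by (auto simp: field_simps)
      moreover have "cos (h * x) = cos (h * y)" using eq by (metis cis.sel(1))
      ultimately have "h * x = h * y" using cos_inj_pi by blast
      then show "x = y" using h by simp
    qed
    have "(\<lambda>x. cis (h * x)) ` {x\<in>{0<..<1/h}. ?f x = 0} \<subseteq> {z. poly p z = 0}"
    proof safe
      fix x assume x: "x \<in> {0<..<1/h}" "?f x = 0"
      then have "(\<Sum>i\<in>UNIV. complex_of_real (a i) * (cis (?t i * x) - 1)) = 0"
        by (auto simp: fbm_spectral_weight_def)
      moreover have "poly p (cis (h * x)) = (\<Sum>i\<in>UNIV. complex_of_real (a i) * (cis (?t i * x) - 1))"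
      proof -
        have "cis (h * x) ^ k i = cis (?t i * x)" for i by (simp add: Complex.DeMoivre mult.assoc)
        then show ?thesis
          by (simp add: p_def poly_sum poly_monom right_diff_distrib sum_subtractf)
      qed
      ultimately show "poly p (cis (h * x)) = 0" by simp
    qed
    with inf inj have "infinite {z. poly p z = 0}"
      by (meson finite_subset finite_imageD)
    then have "p = 0" using poly_roots_finite by blast
    then have "coeff p (k i0) = 0" by simp
    \<comment> \<open>Injectivity of \<open>k\<close> isolates a single monomial in this degree, and
      \<open>0 < k i0\<close> keeps the constant term of \<open>p\<close> out of it.\<close>
    moreover have "coeff p (k i0) = (\<Sum>i\<in>UNIV. if i = i0 then of_real (a i) else 0)"
      using k(2)[of i0] k(1)
      by (auto simp: p_def coeff_sum coeff_pCons inj_eq split: nat.splits intro!: sum.cong)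
    ultimately show False using a by simp
  qed
  moreover have "0 \<le> integral\<^sup>L lborel ?f" using nn by (rule integral_nonneg_AE)
  ultimately have "0 < 2 * ?c * ?Q" using Q by linarith
  then show ?thesis using c by (simp add: zero_less_mult_iff)
qed

lemma mixed_cov_symmetric: "transpose (mixed_cov h m H k) = mixed_cov h m H k"
  by (simp add: mixed_cov_def transpose_def vec_eq_iff fbm_cov_def abs_minus_commute add.commute)

lemma mixed_cov_pos_def:
  fixes k :: "'n::finite \<Rightarrow> nat" and z :: "real^'n"
  assumes h: "0 < h" and m: "m \<ge> 1" and H: "\<And>r. r \<in> {1..m} \<Longrightarrow> 0 < H r \<and> H r < 1"
    and k: "inj k" "\<And>i. 0 < k i" and z: "z \<noteq> 0"
  shows "0 < z \<bullet> (mixed_cov h m H k *v z)"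
proof -
  from z obtain i0 where i0: "z $ i0 \<noteq> 0" by (auto simp: vec_eq_iff)
  let ?g = "\<lambda>r i j. z $ i * z $ j * fbm_cov (H r) (real (k i) * h) (real (k j) * h)"
  have "z \<bullet> (mixed_cov h m H k *v z) = (\<Sum>i\<in>UNIV. \<Sum>j\<in>UNIV. \<Sum>r=1..m. ?g r i j)"
    by (simp add: inner_vec_def matrix_vector_mult_def mixed_cov_def obs_times_def
        sum_distrib_left sum_distrib_right mult.assoc mult.left_commute mult.commute)
  also have "\<dots> = (\<Sum>i\<in>UNIV. \<Sum>r=1..m. \<Sum>j\<in>UNIV. ?g r i j)"
    by (intro sum.cong refl sum.swap)
  also have "\<dots> = (\<Sum>r=1..m. \<Sum>i\<in>UNIV. \<Sum>j\<in>UNIV. ?g r i j)"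
    by (rule sum.swap)
  also have "\<dots> > 0"
  proof (rule sum_pos)
    fix r assume "r \<in> {1..m}"
    with H have "0 < H r" "H r < 1" by auto
    from fbm_cov_quadratic_form_pos[OF this h k, where a="\<lambda>i. z $ i", OF i0]
    show "0 < (\<Sum>i\<in>UNIV. \<Sum>j\<in>UNIV. ?g r i j)" .
  qed (use m in auto)
  finally show ?thesis .
qed

section \<open>Linear images of the standard normal law\<close>

lemma matrix_inv_unique:
  fixes A B :: "real^'n^'n"
  assumes "A ** B = mat 1"
  shows "matrix_inv A = B"
proof -
  have BA: "B ** A = mat 1" using assms matrix_left_right_inverse by blast
  have "A ** matrix_inv A = mat 1 \<and> matrix_inv A ** A = mat 1"
    unfolding matrix_inv_def using assms BA by (intro someI[of "\<lambda>A'. A ** A' = mat 1 \<and> A' ** A = mat 1" B]) auto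
  then have "matrix_inv A = (B ** A) ** matrix_inv A" by (simp add: BA)
  also have "\<dots> = B" using \<open>A ** matrix_inv A = mat 1 \<and> _\<close> by (simp flip: matrix_mul_assoc)
  finally show ?thesis .
qed

lemma inner_matrix_vector_transpose:
  fixes A :: "real^'n^'m"
  shows "x \<bullet> (A *v y) = (transpose A *v x) \<bullet> y"
  by (metis dot_lmul_matrix transpose_matrix_vector)

lemma inner_symmetric_matrix_commute:
  fixes M :: "real^'n^'n"
  assumes "transpose M = M"
  shows "x \<bullet> (M *v y) = y \<bullet> (M *v x)"
  using assms by (metis inner_commute inner_matrix_vector_transpose)

lemma form_orthonormal_independent:
  fixes M :: "real^'n^'n"
  assumes S: "\<And>x y. x \<in> S \<Longrightarrow> y \<in> S \<Longrightarrow> x \<bullet> (M *v y) = (if x = y then 1 else 0)"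
  shows "independent S"
  unfolding independent_explicit_module
proof (intro allI impI)
  fix T u v assume T: "finite T" "T \<subseteq> S" "(\<Sum>w\<in>T. u w *\<^sub>R w) = 0" "v \<in> T"
  have "0 = v \<bullet> (M *v (\<Sum>w\<in>T. u w *\<^sub>R w))" using T(3) by simp
  also have "\<dots> = (\<Sum>w\<in>T. u w * (v \<bullet> (M *v w)))"
    by (simp add: linear_sum[OF matrix_vector_mul_linear] matrix_scaleR_vector_ac inner_sum_right
        scaleR_matrix_vector_assoc[symmetric] o_def)
  also have "\<dots> = (\<Sum>w\<in>T. if w = v then u v else 0)"
    using T S by (intro sum.cong refl) (auto simp: subset_iff)
  also have "\<dots> = u v" using T by simp
  finally show "u v = 0" by simp
qed

text \<open>One Gram-Schmidt step for the inner product defined by \<open>M\<close>: a vector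
  outside the span, minus its projection, divided by its \<open>M\<close>-norm.\<close>

lemma form_orthonormal_extend:
  fixes M :: "real^'n^'n"
  assumes sym: "transpose M = M" and pos: "\<forall>z. z \<noteq> 0 \<longrightarrow> 0 < z \<bullet> (M *v z)"
    and S: "\<And>x y. x \<in> S \<Longrightarrow> y \<in> S \<Longrightarrow> x \<bullet> (M *v y) = (if x = y then 1 else 0)"
    and span: "span S \<noteq> UNIV"
  shows "\<exists>v. v \<notin> S \<and> (\<forall>x\<in>insert v S. \<forall>y\<in>insert v S. x \<bullet> (M *v y) = (if x = y then 1 else 0))"
proof -
  have fin: "finite S" using form_orthonormal_independent[OF S] independent_bound by blast
  obtain x where x: "x \<notin> span S" using span by auto
  define w where "w = x - (\<Sum>s\<in>S. (s \<bullet> (M *v x)) *\<^sub>R s)"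
  have "(\<Sum>s\<in>S. (s \<bullet> (M *v x)) *\<^sub>R s) \<in> span S" by (intro span_sum span_scale span_base)
  then have w: "w \<notin> span S" using x span_add[of w S "\<Sum>s\<in>S. (s \<bullet> (M *v x)) *\<^sub>R s"] by (auto simp: w_def)
  then have w0: "w \<noteq> 0" using span_0 by metis
  have orth: "y \<bullet> (M *v w) = 0" if y: "y \<in> S" for y
  proof -
    have "y \<bullet> (M *v w) = y \<bullet> (M *v x) - (\<Sum>s\<in>S. (s \<bullet> (M *v x)) * (y \<bullet> (M *v s)))"
      by (simp add: w_def matrix_vector_mult_diff_distrib inner_diff_right
          linear_sum[OF matrix_vector_mul_linear] matrix_scaleR_vector_ac inner_sum_right
          scaleR_matrix_vector_assoc[symmetric] o_def)
    also have "(\<Sum>s\<in>S. (s \<bullet> (M *v x)) * (y \<bullet> (M *v s))) = (\<Sum>s\<in>S. if s = y then y \<bullet> (M *v x) else 0)"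
      using y S by (intro sum.cong refl) auto
    also have "\<dots> = y \<bullet> (M *v x)" using y fin by simp
    finally show ?thesis by simp
  qed
  let ?n = "sqrt (w \<bullet> (M *v w))"
  let ?v = "(1 / ?n) *\<^sub>R w"
  have n: "?n > 0" using pos[rule_format, OF w0] by simp
  have vS: "?v \<notin> span S"
  proof
    assume "?v \<in> span S"
    then have "?n *\<^sub>R ?v \<in> span S" by (rule span_scale)
    then show False using w n by simp
  qed
  have yv: "y \<bullet> (M *v ?v) = 0" if "y \<in> S" for y
    using orth[OF that] by (simp add: matrix_scaleR_vector_ac scaleR_matrix_vector_assoc[symmetric])
  have vv: "?v \<bullet> (M *v ?v) = 1"
    using n pos[rule_format, OF w0]
    by (simp add: matrix_scaleR_vector_ac scaleR_matrix_vector_assoc[symmetric] field_simps)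
  have "?v \<notin> S" using vS span_base by blast
  moreover have "x \<bullet> (M *v y) = (if x = y then 1 else 0)" if "x \<in> insert ?v S" "y \<in> insert ?v S" for x y
    using that S yv vv inner_symmetric_matrix_commute[OF sym] \<open>?v \<notin> S\<close> by (metis insertE)
  ultimately show ?thesis by blast
qed

lemma form_orthonormal_matrix:
  fixes M :: "real^'n^'n" and u :: "real^'n"
  assumes sym: "transpose M = M" and pos: "\<forall>z. z \<noteq> 0 \<longrightarrow> 0 < z \<bullet> (M *v z)"
    and u: "u \<bullet> (M *v u) = 1"
  shows "\<exists>C :: real^'n^'n. transpose C ** M ** C = mat 1 \<and> column (i0 :: 'n) C = u"
proof -
  let ?on = "\<lambda>S. \<forall>x\<in>S. \<forall>y\<in>S. x \<bullet> (M *v y) = (if x = y then 1 else 0)"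
  have ind: "independent S" if "?on S" for S using form_orthonormal_independent that by blast
  \<comment> \<open>Orthonormal sets are independent, so their size is bounded by the dimension and
    one containing \<open>u\<close> has maximal size. The Gram-Schmidt step forces it to span the
    space.\<close>
  have "\<exists>S. (u \<in> S \<and> ?on S) \<and> (\<forall>T. u \<in> T \<and> ?on T \<longrightarrow> card T \<le> card S)"
  proof (rule ex_has_greatest_nat)
    show "u \<in> {u} \<and> ?on {u}" using u by simp
    show "\<forall>T. u \<in> T \<and> ?on T \<longrightarrow> card T < Suc DIM(real^'n)"
      using ind independent_bound by (metis le_imp_less_Suc)
  qed
  then obtain S where S': "(u \<in> S \<and> ?on S) \<and> (\<forall>T. u \<in> T \<and> ?on T \<longrightarrow> card T \<le> card S)" ..
  have S: "u \<in> S" "?on S" by (rule conjunct1[OF conjunct1[OF S']], rule conjunct2[OF conjunct1[OF S']])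
  have max: "card T \<le> card S" if "u \<in> T" "?on T" for T
    by (rule conjunct2[OF S', THEN spec, THEN mp, OF conjI[OF that]])
  have fin: "finite S" using ind[OF S(2)] independent_bound by blast
  have "span S = UNIV"
  proof (rule ccontr)
    assume "span S \<noteq> UNIV"
    have "\<exists>v. v \<notin> S \<and> ?on (insert v S)"
      by (rule form_orthonormal_extend[OF sym pos _ \<open>span S \<noteq> UNIV\<close>]) (assumption | rule S(2)[rule_format])+
    then obtain v where v: "v \<notin> S" "?on (insert v S)" by (elim exE conjE)
    have "card (insert v S) \<le> card S" by (rule max[OF _ v(2)]) (use S in simp)
    then show False using v(1) fin by simp
  qed
  then have "card S = CARD('n)"
    using ind[OF S(2)] dim_eq_full[of S] dim_eq_card_independent[of S] by simp
  then obtain g where g: "bij_betw g (UNIV :: 'n set) S"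
    using finite_same_card_bij[OF finite_class.finite_UNIV fin] by auto
  then obtain i1 where i1: "g i1 = u" using S(1) by (metis bij_betw_imp_surj_on imageE)
  \<comment> \<open>An arbitrary enumeration of the basis puts \<open>u\<close> at some index
    \<open>i1\<close>; exchanging the two indices moves it to \<open>i0\<close>.\<close>
  define f where "f = g \<circ> Transposition.transpose i0 i1"
  have f: "bij_betw f UNIV S" unfolding f_def using g by (intro bij_betw_trans[OF _ g]) simp
  have fi: "f i0 = u" by (simp add: f_def i1)
  have fS: "f i \<in> S" for i using f by (auto simp: bij_betw_def)
  have inj: "f i = f j \<longleftrightarrow> i = j" for i j using f by (auto simp: bij_betw_def inj_eq)
  define C :: "real^'n^'n" where "C = (\<chi> i j. f j $ i)"
  have col: "column j C = f j" for j by (simp add: C_def column_def vec_eq_iff)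
  have "(transpose C ** M ** C) $ i $ j = (mat 1 :: real^'n^'n) $ i $ j" for i j
  proof -
    have "(transpose C ** M ** C) $ i $ j = axis i 1 \<bullet> ((transpose C ** M ** C) *v axis j 1)"
      by (simp add: inner_axis' matrix_vector_mult_basis column_def)
    also have "\<dots> = axis i 1 \<bullet> (transpose C *v (M *v (C *v axis j 1)))"
      by (simp only: matrix_vector_mul_assoc matrix_mul_assoc)
    also have "\<dots> = (C *v axis i 1) \<bullet> (M *v (C *v axis j 1))"
      by (subst inner_matrix_vector_transpose) (simp only: transpose_transpose)
    also have "\<dots> = (mat 1 :: real^'n^'n) $ i $ j"
      using S(2) fS inj by (simp add: matrix_vector_mult_basis col mat_def)
    finally show ?thesis .
  qed
  then have "transpose C ** M ** C = mat 1" by (simp add: vec_eq_iff)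
  then show ?thesis using col fi by blast
qed

lemma invertible_imp_matrix_inv:
  fixes A :: "real^'n^'n"
  assumes "invertible A"
  shows "A ** matrix_inv A = mat 1" "matrix_inv A ** A = mat 1"
  using assms matrix_inv_unique unfolding invertible_def by metis+

lemma pos_def_invertible:
  fixes A :: "real^'n^'n"
  assumes pos: "\<forall>z. z \<noteq> 0 \<longrightarrow> 0 < z \<bullet> (A *v z)"
  shows "invertible A"
proof -
  have "z = 0" if "A *v z = 0" for z using pos[rule_format, of z] that by (cases "z = 0") auto
  then show ?thesis
    using matrix_left_invertible_ker[of A] invertible_left_inverse[of A] by metis
qed

lemma pos_def_matrix_inv:
  fixes A :: "real^'n^'n"
  assumes sym: "transpose A = A" and pos: "\<forall>z. z \<noteq> 0 \<longrightarrow> 0 < z \<bullet> (A *v z)"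
  shows "transpose (matrix_inv A) = matrix_inv A" "\<forall>z. z \<noteq> 0 \<longrightarrow> 0 < z \<bullet> (matrix_inv A *v z)"
proof -
  note inv = invertible_imp_matrix_inv[OF pos_def_invertible[OF pos]]
  have "A ** transpose (matrix_inv A) = transpose (matrix_inv A ** A)"
    by (simp add: matrix_transpose_mul sym)
  also have "\<dots> = mat 1" by (simp add: inv transpose_mat)
  finally show "transpose (matrix_inv A) = matrix_inv A" using matrix_inv_unique by metis
  show "\<forall>z. z \<noteq> 0 \<longrightarrow> 0 < z \<bullet> (matrix_inv A *v z)"
  proof (intro allI impI)
    fix z :: "real^'n" assume z: "z \<noteq> 0"
    let ?w = "matrix_inv A *v z"
    have Aw: "A *v ?w = z" by (simp add: matrix_vector_mul_assoc inv)
    then have "?w \<noteq> 0" using z by auto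
    from pos[rule_format, OF this] show "0 < z \<bullet> ?w" by (simp add: Aw inner_commute)
  qed
qed

text \<open>Starting from \<open>T\<close> normalized, take a basis orthonormal for the inverse of
  \<open>A\<close> as the columns of \<open>C\<close>. The relation
  \<open>transpose C ** matrix_inv A ** C = mat 1\<close> then rearranges to
  \<open>A = C ** transpose C\<close>.\<close>

lemma pos_def_factorization:
  fixes A :: "real^'n^'n" and T :: "real^'n"
  assumes sym: "transpose A = A" and pos: "\<forall>z. z \<noteq> 0 \<longrightarrow> 0 < z \<bullet> (A *v z)" and T: "T \<noteq> 0"
  shows "\<exists>C. invertible C \<and> A = C ** transpose C \<and>
    T = sqrt (T \<bullet> (matrix_inv A *v T)) *\<^sub>R column (i0 :: 'n) C"
proof -
  let ?M = "matrix_inv A"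
  let ?s = "sqrt (T \<bullet> (?M *v T))"
  note inv = invertible_imp_matrix_inv[OF pos_def_invertible[OF pos]]
  note M = pos_def_matrix_inv[OF sym pos]
  have s: "?s > 0" using M(2)[rule_format, OF T] by simp
  have "((1 / ?s) *\<^sub>R T) \<bullet> (?M *v ((1 / ?s) *\<^sub>R T)) = 1"
    using s M(2)[rule_format, OF T]
    by (simp add: matrix_scaleR_vector_ac scaleR_matrix_vector_assoc[symmetric] field_simps)
  from form_orthonormal_matrix[OF M(1) M(2) this, of i0]
  obtain C where C: "transpose C ** ?M ** C = mat 1" "column i0 C = (1 / ?s) *\<^sub>R T" by auto
  have inv1: "C ** (transpose C ** ?M) = mat 1" using C(1) matrix_left_right_inverse by metis
  have "A = (C ** (transpose C ** ?M)) ** A" by (simp add: inv1)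
  also have "\<dots> = C ** transpose C ** (?M ** A)" by (simp add: matrix_mul_assoc)
  finally have "A = C ** transpose C" by (simp add: inv)
  moreover have "invertible C" using inv1 C(1) unfolding invertible_def by blast
  moreover have "T = ?s *\<^sub>R column i0 C" using s by (simp add: C(2))
  ultimately show ?thesis by blast
qed

text \<open>The inverse of \<open>D ** transpose D\<close> is the transposed inverse of
  \<open>D\<close> times the inverse of \<open>D\<close>, so passing to coordinates with respect to
  \<open>D\<close> turns the precision form into the Euclidean one.\<close>

lemma matrix_inv_mult_transpose_vector:
  fixes D :: "real^'n^'n"
  assumes "invertible D"
  shows "(D *v x) \<bullet> (matrix_inv (D ** transpose D) *v (D *v y)) = x \<bullet> y"
proof -
  let ?E = "matrix_inv D"
  note inv = invertible_imp_matrix_inv[OF assms]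
  have t: "transpose D ** transpose ?E = mat 1"
    using inv(2) by (metis matrix_transpose_mul transpose_mat)
  have "(D ** transpose D) ** (transpose ?E ** ?E) = D ** (transpose D ** transpose ?E) ** ?E"
    by (simp add: matrix_mul_assoc)
  also have "\<dots> = mat 1" by (simp add: t inv)
  finally have eq: "matrix_inv (D ** transpose D) = transpose ?E ** ?E" by (rule matrix_inv_unique)
  have "(D *v x) \<bullet> (matrix_inv (D ** transpose D) *v (D *v y))
     = (D *v x) \<bullet> (transpose ?E *v (?E *v (D *v y)))"
    by (simp only: eq matrix_vector_mul_assoc matrix_mul_assoc)
  also have "\<dots> = (?E *v (D *v x)) \<bullet> (?E *v (D *v y))"
    by (subst inner_matrix_vector_transpose) (simp only: transpose_transpose)
  finally show ?thesis by (simp add: matrix_vector_mul_assoc inv)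
qed

section \<open>Lebesgue integrals under invertible linear maps\<close>

lemma nn_integral_lborel_swap:
  fixes h :: "real^'n \<Rightarrow> ennreal" and m n :: "'n"
  assumes [measurable]: "h \<in> borel_measurable borel"
  shows "(\<integral>\<^sup>+x. h (\<chi> i. x $ Transposition.transpose m n i) \<partial>lborel) = (\<integral>\<^sup>+x. h x \<partial>lborel)"
proof -
  let ?t = "Transposition.transpose m n"
  let ?f = "\<lambda>x :: real^'n. \<chi> i. x $ ?t i"
  have "continuous_on UNIV ?f" by (intro continuous_intros)
  then have [measurable]: "?f \<in> borel_measurable borel" by (rule borel_measurable_continuous_onI)
  have "lborel = distr lborel borel ?f"
  proof (rule lborel_eqI)
    fix l u :: "real^'n" assume le: "\<And>b. b \<in> Basis \<Longrightarrow> l \<bullet> b \<le> u \<bullet> b"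
    have le': "l $ i \<le> u $ i" for i
      using le[of "axis i 1"] by (simp add: inner_axis axis_in_Basis_iff)
    have "?f -` box l u = box (?f l) (?f u)"
    proof (intro set_eqI)
      fix x
      have "(\<forall>i. l $ i < x $ ?t i \<and> x $ ?t i < u $ i) \<longleftrightarrow> (\<forall>i. l $ ?t i < x $ i \<and> x $ i < u $ ?t i)"
        by (metis transpose_involutory)
      then show "x \<in> ?f -` box l u \<longleftrightarrow> x \<in> box (?f l) (?f u)" by (simp add: mem_box_cart)
    qed
    moreover have "emeasure lborel (box (?f l) (?f u)) = ennreal (\<Prod>b\<in>Basis. (?f u - ?f l) \<bullet> b)"
      using le' by (subst emeasure_lborel_box) (auto simp: Basis_vec_def inner_axis)
    moreover have "(\<Prod>b\<in>Basis. (?f u - ?f l) \<bullet> b) = (\<Prod>i\<in>UNIV. (u - l) $ ?t i)"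
      by (simp add: Basis_vec_def inner_axis UNION_singleton_eq_range prod.reindex inj_on_def axis_eq_axis)
    moreover have "\<dots> = (\<Prod>i\<in>UNIV. (u - l) $ i)"
      using prod.permute[OF permutes_swap_id, of m UNIV n "\<lambda>i. (u - l) $ i"] by (simp add: comp_def)
    moreover have "\<dots> = (\<Prod>b\<in>Basis. (u - l) \<bullet> b)"
      by (simp add: Basis_vec_def inner_axis UNION_singleton_eq_range prod.reindex inj_on_def axis_eq_axis)
    ultimately show "emeasure (distr lborel borel ?f) (box l u) = (\<Prod>b\<in>Basis. (u - l) \<bullet> b)"
      by (simp add: emeasure_distr)
  qed simp
  then have "(\<integral>\<^sup>+x. h x \<partial>lborel) = (\<integral>\<^sup>+x. h x \<partial>distr lborel borel ?f)" by simp
  also have "\<dots> = (\<integral>\<^sup>+x. h (?f x) \<partial>lborel)" by (rule nn_integral_distr) auto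
  finally show ?thesis by simp
qed

text \<open>Integrating out coordinate \<open>m\<close> first, a shear is a translation on the real line.\<close>

lemma nn_integral_lborel_shear:
  fixes h :: "real^'n \<Rightarrow> ennreal" and m n :: "'n"
  assumes [measurable]: "h \<in> borel_measurable borel" and mn: "m \<noteq> n"
  shows "(\<integral>\<^sup>+x. h (x + axis m (x $ n)) \<partial>lborel) = (\<integral>\<^sup>+x. h x \<partial>lborel)"
proof -
  interpret product_sigma_finite "\<lambda>_ :: real^'n. lborel :: real measure" by standard
  let ?B = "Basis :: (real^'n) set" and ?e = "axis m 1 :: real^'n"
  let ?v = "\<lambda>f. \<Sum>b\<in>?B. f b *\<^sub>R b"
  have e: "?e \<in> ?B" by (simp add: axis_in_Basis_iff)
  have v[measurable]: "?v \<in> (\<Pi>\<^sub>M b\<in>?B. lborel) \<rightarrow>\<^sub>M borel" by measurable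
  have vu: "?v (f(?e := y)) = ?v (f(?e := 0)) + y *\<^sub>R ?e" for f y
    using e by (simp add: sum.remove[of ?B ?e])
  have step: "(\<integral>\<^sup>+x. k x \<partial>lborel)
    = (\<integral>\<^sup>+f. (\<integral>\<^sup>+y. k (?v (f(?e := 0)) + y *\<^sub>R ?e) \<partial>lborel) \<partial>(\<Pi>\<^sub>M b\<in>?B - {?e}. lborel))"
    if [measurable]: "k \<in> borel_measurable borel" for k :: "real^'n \<Rightarrow> ennreal"
  proof -
    have "(\<integral>\<^sup>+x. k x \<partial>lborel) = (\<integral>\<^sup>+f. k (?v f) \<partial>(\<Pi>\<^sub>M b\<in>insert ?e (?B - {?e}). lborel))"
      by (subst lborel_eq) (simp add: nn_integral_distr insert_absorb[OF e])
    also have "\<dots> = (\<integral>\<^sup>+f. (\<integral>\<^sup>+y. k (?v (f(?e := y))) \<partial>lborel) \<partial>(\<Pi>\<^sub>M b\<in>?B - {?e}. lborel))"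
      by (rule product_nn_integral_insert) (auto simp: insert_absorb[OF e])
    also have "\<dots> = (\<integral>\<^sup>+f. (\<integral>\<^sup>+y. k (?v (f(?e := 0)) + y *\<^sub>R ?e) \<partial>lborel) \<partial>(\<Pi>\<^sub>M b\<in>?B - {?e}. lborel))"
      by (intro nn_integral_cong arg_cong[where f=k] vu)
    finally show ?thesis .
  qed
  have [measurable]: "(\<lambda>x :: real^'n. x + axis m (x $ n)) \<in> borel_measurable borel"
  proof -
    have "(\<lambda>x :: real^'n. x + axis m (x $ n)) = (\<lambda>x. x + (x $ n) *\<^sub>R ?e)"
      by (auto simp: fun_eq_iff vec_eq_iff axis_def)
    also have "\<dots> \<in> borel_measurable borel"
      by (intro borel_measurable_continuous_onI continuous_intros)
    finally show ?thesis .
  qed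
  have inner: "(\<integral>\<^sup>+y. h (x + y *\<^sub>R ?e + axis m ((x + y *\<^sub>R ?e) $ n)) \<partial>lborel) = (\<integral>\<^sup>+y. h (x + y *\<^sub>R ?e) \<partial>lborel)" for x
  proof -
    have eq: "x + y *\<^sub>R ?e + axis m ((x + y *\<^sub>R ?e) $ n) = x + (x $ n + 1 * y) *\<^sub>R ?e" for y
      using mn by (auto simp: vec_eq_iff axis_def)
    show ?thesis
      unfolding eq using nn_integral_real_affine[of "\<lambda>y. h (x + y *\<^sub>R ?e)" 1 "x $ n"] by simp
  qed
  have "(\<lambda>x. h (x + axis m (x $ n))) \<in> borel_measurable borel" by measurable
  then show ?thesis by (simp only: step[OF assms(1)] step inner)
qed

text \<open>Linear maps are generated by diagonal maps, coordinate swaps, shears and maps with a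
  zero coordinate. The claim is guarded by \<open>inj f\<close> because of the last kind, and
  quantified over all \<open>h\<close> so that for a composition \<open>h\<close> can be replaced by
  \<open>h (f x)\<close>.\<close>

lemma nn_integral_lborel_linear:
  fixes f :: "real^'n \<Rightarrow> real^'n"
  assumes "linear f"
  shows "inj f \<longrightarrow> (\<forall>h :: real^'n \<Rightarrow> ennreal. h \<in> borel_measurable borel \<longrightarrow>
    (\<integral>\<^sup>+x. h x \<partial>lborel) = ennreal \<bar>det (matrix f)\<bar> * (\<integral>\<^sup>+x. h (f x) \<partial>lborel))"
  using assms
proof (rule induct_linear_elementary; intro impI allI)
  fix f g :: "real^'n \<Rightarrow> real^'n" and h :: "real^'n \<Rightarrow> ennreal"
  assume lin: "linear f" "linear g" and inj: "inj (f \<circ> g)" and h[measurable]: "h \<in> borel_measurable borel"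
    and f: "inj f \<longrightarrow> (\<forall>h :: real^'n \<Rightarrow> ennreal. h \<in> borel_measurable borel \<longrightarrow>
      (\<integral>\<^sup>+x. h x \<partial>lborel) = ennreal \<bar>det (matrix f)\<bar> * (\<integral>\<^sup>+x. h (f x) \<partial>lborel))"
    and g: "inj g \<longrightarrow> (\<forall>h :: real^'n \<Rightarrow> ennreal. h \<in> borel_measurable borel \<longrightarrow>
      (\<integral>\<^sup>+x. h x \<partial>lborel) = ennreal \<bar>det (matrix g)\<bar> * (\<integral>\<^sup>+x. h (g x) \<partial>lborel))"
  have ig: "inj g" using inj by (rule inj_on_imageI2)
  have "surj g" using lin(2) ig linear_injective_imp_surjective by blast
  then have "inj f" using inj by (metis comp_inj_on_iff inj_on_subset o_def inj_on_imageI)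
  have [measurable]: "f \<in> borel_measurable borel"
    using lin(1) by (intro borel_measurable_continuous_onI linear_continuous_on linear_conv_bounded_linear[THEN iffD1])
  have "(\<integral>\<^sup>+x. h x \<partial>lborel) = ennreal \<bar>det (matrix f)\<bar> * (\<integral>\<^sup>+x. h (f x) \<partial>lborel)"
    using f \<open>inj f\<close> h by blast
  also have "(\<integral>\<^sup>+x. h (f x) \<partial>lborel) = ennreal \<bar>det (matrix g)\<bar> * (\<integral>\<^sup>+x. h (f (g x)) \<partial>lborel)"
    using g[rule_format, OF ig, of "\<lambda>x. h (f x)"] by simp
  finally show "(\<integral>\<^sup>+x. h x \<partial>lborel) = ennreal \<bar>det (matrix (f \<circ> g))\<bar> * (\<integral>\<^sup>+x. h ((f \<circ> g) x) \<partial>lborel)"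
    by (simp add: matrix_compose[OF lin(2,1)] det_mul abs_mult ennreal_mult mult.assoc)
next
  fix f :: "real^'n \<Rightarrow> real^'n" and i and h :: "real^'n \<Rightarrow> ennreal"
  assume "linear f" "inj f" and 0: "\<And>x. f x $ i = 0"
  then have "surj f" using linear_injective_imp_surjective by blast
  then obtain x where "axis i 1 = f x" by (metis surjD)
  then show "(\<integral>\<^sup>+x. h x \<partial>lborel) = ennreal \<bar>det (matrix f)\<bar> * (\<integral>\<^sup>+x. h (f x) \<partial>lborel)"
    using 0[of x] by (metis axis_nth zero_neq_one)
next
  fix c :: "'n \<Rightarrow> real" and h :: "real^'n \<Rightarrow> ennreal"
  let ?f = "\<lambda>x :: real^'n. \<chi> i. c i * x $ i"
  assume inj: "inj ?f" and [measurable]: "h \<in> borel_measurable borel"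
  have c: "c i \<noteq> 0" for i
  proof
    assume "c i = 0"
    then have "?f (axis i 1) = ?f 0" by (auto simp: vec_eq_iff axis_def)
    then have "axis i 1 = (0 :: real^'n)" using inj by (rule injD[rotated])
    then show False by (simp add: axis_eq_0_iff)
  qed
  \<comment> \<open>\<open>lborel_affine_euclidean\<close> takes its scaling factors indexed by
    basis vectors; \<open>c'\<close> carries the factors \<open>c\<close> over to that
    indexing.\<close>
  define c' where "c' b = (\<Sum>i\<in>UNIV. c i * (b $ i))" for b :: "real^'n"
  have c': "c' (axis i 1) = c i" for i
    by (simp add: c'_def axis_def if_distrib[of "\<lambda>z. _ * z"] cong: if_cong)
  have B: "(\<Sum>b\<in>Basis. k b) = (\<Sum>i\<in>UNIV. k (axis i 1))" "(\<Prod>b\<in>Basis. l b) = (\<Prod>i\<in>UNIV. l (axis i 1))"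
    for k :: "real^'n \<Rightarrow> real^'n" and l :: "real^'n \<Rightarrow> real"
    by (simp_all add: Basis_vec_def UNION_singleton_eq_range sum.reindex prod.reindex inj_on_def axis_eq_axis)
  have f: "?f x = 0 + (\<Sum>b\<in>Basis. (c' b * (x \<bullet> b)) *\<^sub>R b)" for x
    unfolding B c' by (simp add: vec_eq_iff inner_axis) (simp add: axis_def if_distrib[of "\<lambda>z. _ * z"] cong: if_cong)
  have fm: "?f \<in> borel_measurable borel"
    by (intro borel_measurable_continuous_onI continuous_intros)
  have lb: "lborel = density (distr lborel borel ?f) (\<lambda>_. ennreal (\<Prod>b\<in>Basis. \<bar>c' b\<bar>))"
    unfolding f by (rule lborel_affine_euclidean) (auto simp: Basis_vec_def c' c)
  have "(\<integral>\<^sup>+x. h x \<partial>lborel) = ennreal (\<Prod>b\<in>Basis. \<bar>c' b\<bar>) * (\<integral>\<^sup>+x. h (?f x) \<partial>lborel)"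
    using fm by (subst lb) (simp add: nn_integral_density nn_integral_cmult nn_integral_distr)
  also have "(\<Prod>b\<in>Basis. \<bar>c' b\<bar>) = \<bar>det (matrix ?f)\<bar>"
    unfolding B c' by (subst det_diagonal) (auto simp: matrix_def axis_def abs_prod)
  finally show "(\<integral>\<^sup>+x. h x \<partial>lborel) = ennreal \<bar>det (matrix ?f)\<bar> * (\<integral>\<^sup>+x. h (?f x) \<partial>lborel)" .
next
  fix m n :: "'n" and h :: "real^'n \<Rightarrow> ennreal"
  let ?f = "\<lambda>x :: real^'n. \<chi> i. x $ Transposition.transpose m n i"
  assume h: "h \<in> borel_measurable borel"
  have "matrix ?f = (\<chi> i. (mat 1 :: real^'n^'n) $ Transposition.transpose m n i)"
    by (simp add: matrix_def mat_def axis_def vec_eq_iff)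
  then have "\<bar>det (matrix ?f)\<bar> = 1"
    using det_permute_rows[of "Transposition.transpose m n" "mat 1 :: real^'n^'n"]
    by (simp add: sign_swap_id permutes_swap_id)
  then show "(\<integral>\<^sup>+x. h x \<partial>lborel) = ennreal \<bar>det (matrix ?f)\<bar> * (\<integral>\<^sup>+x. h (?f x) \<partial>lborel)"
    using nn_integral_lborel_swap[OF h, of m n] by simp
next
  fix m n :: "'n" and h :: "real^'n \<Rightarrow> ennreal"
  let ?f = "\<lambda>x :: real^'n. \<chi> i. if i = m then x $ m + x $ n else x $ i"
  assume mn: "m \<noteq> n" and h: "h \<in> borel_measurable borel"
  have "matrix ?f = (\<chi> k. if k = m then row m (mat 1 :: real^'n^'n) + 1 *s row n (mat 1) else row k (mat 1))"
    by (auto simp: matrix_def mat_def axis_def vec_eq_iff row_def)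
  then have "det (matrix ?f) = 1" using det_row_operation[OF mn, of "mat 1 :: real^'n^'n" 1] by simp
  moreover have "?f x = x + axis m (x $ n)" for x by (auto simp: vec_eq_iff axis_def)
  ultimately show "(\<integral>\<^sup>+x. h x \<partial>lborel) = ennreal \<bar>det (matrix ?f)\<bar> * (\<integral>\<^sup>+x. h (?f x) \<partial>lborel)"
    using nn_integral_lborel_shear[OF h mn] by simp
qed

lemma lborel_affine_matrix:
  fixes D :: "real^'n^'n" and \<mu> :: "real^'n"
  assumes "invertible D"
  shows "lborel = density (distr lborel borel (\<lambda>x. \<mu> + D *v x)) (\<lambda>_. ennreal \<bar>det D\<bar>)"
proof (rule measure_eqI)
  let ?T = "\<lambda>x. \<mu> + D *v x"
  have T[measurable]: "?T \<in> borel_measurable borel"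
    by (intro borel_measurable_continuous_onI continuous_intros matrix_vector_mult_linear_continuous_on)
  fix A :: "(real^'n) set" assume "A \<in> sets lborel"
  then have [measurable]: "A \<in> sets borel" by simp
  have "(\<integral>\<^sup>+x. indicator A x \<partial>lborel) = (\<integral>\<^sup>+x. indicator A x \<partial>distr lborel borel ((+) \<mu>))"
    by (simp add: lborel_distr_plus)
  also have "\<dots> = (\<integral>\<^sup>+x. indicator A (\<mu> + x) \<partial>lborel)" by (rule nn_integral_distr) auto
  also have "\<dots> = ennreal \<bar>det D\<bar> * (\<integral>\<^sup>+x. indicator A (?T x) \<partial>lborel)"
    using nn_integral_lborel_linear[OF matrix_vector_mul_linear[of D], rule_format,
        OF inj_matrix_vector_mult[OF assms], of "\<lambda>x. indicator A (\<mu> + x)"] by simp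
  finally show "emeasure lborel A = emeasure (density (distr lborel borel ?T) (\<lambda>_. ennreal \<bar>det D\<bar>)) A"
    by (simp add: emeasure_density nn_integral_cmult nn_integral_distr del: nn_integral_indicator)
       (simp add: nn_integral_distr flip: nn_integral_indicator)
qed simp

section \<open>The standard normal vector and its affine images\<close>

definition std_normal_vec :: "(real^'n::finite) measure" where
  "std_normal_vec = density lborel (\<lambda>x. ennreal (\<Prod>i\<in>UNIV. std_normal_density (x $ i)))"

lemma prod_std_normal_density:
  fixes x :: "real^'n"
  shows "(\<Prod>i\<in>UNIV. std_normal_density (x $ i)) = exp (- (x \<bullet> x) / 2) / sqrt ((2 * pi) ^ CARD('n))"
proof -
  have "(\<Prod>i\<in>UNIV. std_normal_density (x $ i)) = (\<Prod>i\<in>UNIV. exp (- (x $ i)\<^sup>2 / 2)) / sqrt (2 * pi) ^ CARD('n)"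
    by (simp add: normal_density_def prod_dividef)
  also have "(\<Prod>i\<in>UNIV. exp (- (x $ i)\<^sup>2 / 2)) = exp (\<Sum>i\<in>UNIV. - (x $ i)\<^sup>2 / 2)"
    by (simp add: exp_sum)
  also have "(\<Sum>i\<in>UNIV. - (x $ i)\<^sup>2 / 2) = - (x \<bullet> x) / 2"
    by (simp add: inner_vec_def power2_eq_square sum_negf sum_divide_distrib)
  finally show ?thesis by (simp only: real_sqrt_power)
qed

text \<open>Substituting \<open>\<mu> + D *v x\<close> for \<open>z\<close> makes the exponent
  Euclidean, and the Jacobian \<open>\<bar>det D\<bar>\<close> cancels against the root of
  \<open>det (D ** transpose D)\<close>.\<close>

lemma multivariate_normal_eq_distr:
  fixes D :: "real^'n^'n" and \<mu> :: "real^'n"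
  assumes "invertible D"
  shows "multivariate_normal \<mu> (D ** transpose D) = distr std_normal_vec borel (\<lambda>x. \<mu> + D *v x)"
proof -
  let ?T = "\<lambda>x. \<mu> + D *v x"
  let ?f = "\<lambda>z. ennreal (exp (- ((z - \<mu>) \<bullet> (matrix_inv (D ** transpose D) *v (z - \<mu>))) / 2)
    / sqrt ((2 * pi) ^ CARD('n) * det (D ** transpose D)))"
  have T[measurable]: "?T \<in> borel_measurable borel"
    by (intro borel_measurable_continuous_onI continuous_intros matrix_vector_mult_linear_continuous_on)
  have "continuous_on UNIV (\<lambda>z. matrix_inv (D ** transpose D) *v (z - \<mu>))"
    by (rule continuous_on_compose2[OF matrix_vector_mult_linear_continuous_on[of UNIV]])
      (auto intro!: continuous_intros)
  then have [measurable]: "(\<lambda>z. matrix_inv (D ** transpose D) *v (z - \<mu>)) \<in> borel_measurable borel"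
    by (rule borel_measurable_continuous_onI)
  have f[measurable]: "?f \<in> borel_measurable borel" by measurable
  have d: "det D \<noteq> 0" using assms by (simp add: invertible_det_nz)
  have "multivariate_normal \<mu> (D ** transpose D)
     = density (density (distr lborel borel ?T) (\<lambda>_. ennreal \<bar>det D\<bar>)) ?f"
    unfolding multivariate_normal_def by (subst lborel_affine_matrix[OF assms, of \<mu>]) (rule refl)
  also have "\<dots> = density (distr lborel borel ?T) (\<lambda>z. ennreal \<bar>det D\<bar> * ?f z)"
    by (subst density_density_eq) auto
  also have "\<dots> = distr (density lborel (\<lambda>x. ennreal \<bar>det D\<bar> * ?f (?T x))) borel ?T"
    by (subst density_distr) auto
  also have "(\<lambda>x. ennreal \<bar>det D\<bar> * ?f (?T x)) = (\<lambda>x. ennreal (\<Prod>i\<in>UNIV. std_normal_density (x $ i)))"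
  proof
    fix x
    have "sqrt ((2 * pi) ^ CARD('n) * det (D ** transpose D)) = sqrt ((2 * pi) ^ CARD('n)) * \<bar>det D\<bar>"
      by (simp add: det_mul det_transpose real_sqrt_mult)
    then show "ennreal \<bar>det D\<bar> * ?f (?T x) = ennreal (\<Prod>i\<in>UNIV. std_normal_density (x $ i))"
      using d unfolding prod_std_normal_density
      by (simp add: matrix_inv_mult_transpose_vector[OF assms] ennreal_mult'[symmetric])
  qed
  finally show ?thesis by (simp add: std_normal_vec_def)
qed

section \<open>Moments of the residual sum of squares\<close>

lemma sets_std_normal_vec [simp, measurable_cong]: "sets std_normal_vec = sets borel"
  by (simp add: std_normal_vec_def)

lemma space_std_normal_vec [simp]: "space std_normal_vec = UNIV"
  by (simp add: std_normal_vec_def)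

lemma nn_integral_std_normal_vec_prod:
  fixes f :: "'n::finite \<Rightarrow> real \<Rightarrow> ennreal"
  assumes [measurable]: "\<And>i. f i \<in> borel_measurable borel"
  shows "(\<integral>\<^sup>+x. (\<Prod>i\<in>UNIV. f i (x $ i)) \<partial>std_normal_vec)
    = (\<Prod>i\<in>UNIV. \<integral>\<^sup>+y. ennreal (std_normal_density y) * f i y \<partial>lborel)"
proof -
  \<comment> \<open>Recovers the index of a coordinate axis, since
    \<open>nn_integral_lborel_prod\<close> takes factors indexed by \<open>Basis\<close>.\<close>
  define j :: "real^'n \<Rightarrow> 'n" where "j b = (SOME i. b = axis i 1)" for b
  have j: "j (axis i 1) = i" for i by (simp add: j_def axis_eq_axis)
  have B: "(\<Prod>b\<in>Basis. l b) = (\<Prod>i\<in>UNIV. l (axis i 1))" for l :: "real^'n \<Rightarrow> ennreal"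
    by (simp add: Basis_vec_def UNION_singleton_eq_range prod.reindex inj_on_def axis_eq_axis)
  let ?g = "\<lambda>i y. ennreal (std_normal_density y) * f i y"
  have "(\<integral>\<^sup>+x. (\<Prod>i\<in>UNIV. f i (x $ i)) \<partial>std_normal_vec)
    = (\<integral>\<^sup>+x. (\<Prod>i\<in>UNIV. ?g i (x $ i)) \<partial>lborel)"
    unfolding std_normal_vec_def
    by (subst nn_integral_density) (auto simp: prod.distrib prod_ennreal normal_density_nonneg)
  also have "\<dots> = (\<integral>\<^sup>+x. (\<Prod>b\<in>Basis. ?g (j b) (x \<bullet> b)) \<partial>lborel)"
    by (simp add: B j cart_eq_inner_axis)
  also have "\<dots> = (\<Prod>b\<in>Basis. \<integral>\<^sup>+y. ?g (j b) y \<partial>lborel)"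
    by (rule nn_integral_lborel_prod) auto
  also have "\<dots> = (\<Prod>i\<in>UNIV. \<integral>\<^sup>+y. ?g i y \<partial>lborel)" by (simp add: B j)
  finally show ?thesis .
qed

lemma nn_integral_std_normal_density [simp]:
  "(\<integral>\<^sup>+y. ennreal (std_normal_density y) \<partial>lborel) = 1"
  using prob_space.emeasure_space_1[OF prob_space_normal_density[of 1 0]]
  by (simp add: emeasure_density)

lemma prob_space_std_normal_vec: "prob_space (std_normal_vec :: (real^'n::finite) measure)"
proof
  show "emeasure (std_normal_vec :: (real^'n) measure) (space std_normal_vec) = 1"
    using nn_integral_std_normal_vec_prod[of "\<lambda>(_::'n) _. 1"]
    by simp
qed

lemma distr_std_normal_vec_nth:
  "distr std_normal_vec borel (\<lambda>x :: real^'n::finite. x $ i) = density lborel std_normal_density"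
proof (rule measure_eqI)
  fix A :: "real set" assume "A \<in> sets (distr std_normal_vec borel (\<lambda>x :: real^'n. x $ i))"
  then have [measurable]: "A \<in> sets borel" by simp
  have "emeasure (distr std_normal_vec borel (\<lambda>x :: real^'n. x $ i)) A
    = (\<integral>\<^sup>+x. indicator A (x $ i) \<partial>(std_normal_vec :: (real^'n) measure))"
    by (simp add: nn_integral_distr flip: nn_integral_indicator)
  also have "\<dots> = (\<integral>\<^sup>+x. (\<Prod>l\<in>UNIV. if l = i then indicator A (x $ l) else 1) \<partial>(std_normal_vec :: (real^'n) measure))"
    by simp
  also have "\<dots> = (\<Prod>l\<in>(UNIV :: 'n set). \<integral>\<^sup>+y. ennreal (std_normal_density y) * (if l = i then indicator A y else 1) \<partial>lborel)"
    by (subst nn_integral_std_normal_vec_prod[where f="\<lambda>l y. if l = i then indicator A y else 1"]) auto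
  also have "\<dots> = (\<Prod>l\<in>(UNIV :: 'n set). if l = i then \<integral>\<^sup>+y. ennreal (std_normal_density y) * indicator A y \<partial>lborel else 1)"
    by (intro prod.cong refl) auto
  also have "\<dots> = emeasure (density lborel std_normal_density) A"
    by (simp add: emeasure_density)
  finally show "emeasure (distr std_normal_vec borel (\<lambda>x :: real^'n. x $ i)) A
    = emeasure (density lborel std_normal_density) A" .
qed simp

lemma std_normal_vec_nth:
  fixes g :: "real \<Rightarrow> real"
  assumes [measurable]: "g \<in> borel_measurable borel"
  shows "integrable std_normal_vec (\<lambda>x :: real^'n::finite. g (x $ i))
      \<longleftrightarrow> integrable lborel (\<lambda>y. std_normal_density y * g y)"
    and "(\<integral>x. g (x $ i) \<partial>(std_normal_vec :: (real^'n::finite) measure)) = (\<integral>y. std_normal_density y * g y \<partial>lborel)"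
proof -
  have "integrable std_normal_vec (\<lambda>x :: real^'n. g (x $ i))
    \<longleftrightarrow> integrable (distr std_normal_vec borel (\<lambda>x :: real^'n. x $ i)) g"
    by (subst integrable_distr_eq) auto
  then show "integrable std_normal_vec (\<lambda>x :: real^'n. g (x $ i))
      \<longleftrightarrow> integrable lborel (\<lambda>y. std_normal_density y * g y)"
    unfolding distr_std_normal_vec_nth by (simp add: integrable_density normal_density_nonneg)
  have "(\<integral>x. g (x $ i) \<partial>(std_normal_vec :: (real^'n) measure)) = integral\<^sup>L (distr std_normal_vec borel (\<lambda>x :: real^'n. x $ i)) g"
    by (subst integral_distr) auto
  then show "(\<integral>x. g (x $ i) \<partial>(std_normal_vec :: (real^'n) measure)) = (\<integral>y. std_normal_density y * g y \<partial>lborel)"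
    unfolding distr_std_normal_vec_nth by (simp add: integral_density normal_density_nonneg)
qed

lemma std_normal_vec_moments:
  shows "integrable std_normal_vec (\<lambda>x :: real^'n::finite. (x $ i) ^ k)"
    and "(\<integral>x. x $ i \<partial>(std_normal_vec :: (real^'n::finite) measure)) = 0"
    and "(\<integral>x. (x $ i)\<^sup>2 \<partial>(std_normal_vec :: (real^'n::finite) measure)) = 1"
proof -
  show "integrable std_normal_vec (\<lambda>x :: real^'n. (x $ i) ^ k)"
    using std_normal_vec_nth(1)[of "\<lambda>y. y ^ k" i] integrable_normal_moment[of 1 0 k] by simp
  show "(\<integral>x. x $ i \<partial>(std_normal_vec :: (real^'n) measure)) = 0"
    using std_normal_vec_nth(2)[of "\<lambda>y. y" i] integral_normal_moment_nz_1[of 1 0] by simp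
  show "(\<integral>x. (x $ i)\<^sup>2 \<partial>(std_normal_vec :: (real^'n) measure)) = 1"
    using std_normal_vec_nth(2)[of "\<lambda>y. y\<^sup>2" i] integral_normal_moment_even[of 1 0 1] by simp
qed

text \<open>Coordinate \<open>i0\<close> is the one that carries the drift. Under
  \<open>std_normal_vec\<close> this is a chi-square variable with \<open>CARD('n) - 1\<close>
  degrees of freedom; only its moments are computed.\<close>

definition residual_sq :: "'n \<Rightarrow> real^'n::finite \<Rightarrow> real" where
  "residual_sq i0 x = (\<Sum>i\<in>UNIV - {i0}. (x $ i)\<^sup>2)"

lemma residual_sq_nonneg [simp]: "0 \<le> residual_sq i0 x"
  by (simp add: residual_sq_def sum_nonneg)

lemma residual_sq_measurable [measurable]: "residual_sq i0 \<in> borel_measurable borel"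
  unfolding residual_sq_def[abs_def] by measurable

text \<open>The square is bounded through Cauchy-Schwarz by fourth moments of the coordinates; this
  gives the square integrability required for uniqueness of the estimator of the variance.\<close>

lemma residual_sq_moments:
  fixes i0 :: "'n::finite"
  shows "integrable std_normal_vec (residual_sq i0)"
    and "(\<integral>x. residual_sq i0 x \<partial>std_normal_vec) = real CARD('n) - 1"
    and "integrable std_normal_vec (\<lambda>x. (residual_sq i0 x)\<^sup>2)"
    and "integrable std_normal_vec (\<lambda>x. sqrt (residual_sq i0 x))"
proof -
  interpret prob_space "std_normal_vec :: (real^'n) measure" by (rule prob_space_std_normal_vec)
  show i: "integrable std_normal_vec (residual_sq i0)"
    unfolding residual_sq_def[abs_def] by (intro Bochner_Integration.integrable_sum std_normal_vec_moments)
  show "(\<integral>x. residual_sq i0 x \<partial>std_normal_vec) = real CARD('n) - 1"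
    unfolding residual_sq_def
    by (subst Bochner_Integration.integral_sum) (simp_all add: std_normal_vec_moments card_Diff_singleton)
  show "integrable std_normal_vec (\<lambda>x. (residual_sq i0 x)\<^sup>2)"
  proof (rule Bochner_Integration.integrable_bound)
    show "integrable std_normal_vec (\<lambda>x. real CARD('n) * (\<Sum>i\<in>UNIV - {i0}. (x $ i) ^ 4))"
      by (intro integrable_mult_right Bochner_Integration.integrable_sum std_normal_vec_moments)
    have "(residual_sq i0 x)\<^sup>2 \<le> real CARD('n) * (\<Sum>i\<in>UNIV - {i0}. (x $ i) ^ 4)" for x
    proof -
      have "(residual_sq i0 x)\<^sup>2 \<le> real (card (UNIV - {i0})) * (\<Sum>i\<in>UNIV - {i0}. ((x $ i)\<^sup>2)\<^sup>2)"
        unfolding residual_sq_def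
        using sum_squared_le_sum_of_squares[of "\<lambda>i. (x $ i)\<^sup>2" "UNIV - {i0}"] by (simp add: mult.commute)
      also have "\<dots> \<le> real CARD('n) * (\<Sum>i\<in>UNIV - {i0}. ((x $ i)\<^sup>2)\<^sup>2)"
        by (intro mult_right_mono sum_nonneg) (auto intro: card_mono)
      finally show ?thesis by (simp flip: power_mult)
    qed
    then show "AE x in std_normal_vec. norm ((residual_sq i0 x)\<^sup>2)
      \<le> norm (real CARD('n) * (\<Sum>i\<in>UNIV - {i0}. (x $ i) ^ 4))"
      by (auto intro!: AE_I2 order_trans[OF _ abs_ge_self])
  qed measurable
  show "integrable std_normal_vec (\<lambda>x. sqrt (residual_sq i0 x))"
  proof (rule Bochner_Integration.integrable_bound)
    show "integrable std_normal_vec (\<lambda>x. 1 + residual_sq i0 x)" using i by simp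
    have "sqrt r \<le> 1 + r" if "r \<ge> 0" for r :: real
      using that arith_geo_mean_sqrt[of 1 r] by simp
    then show "AE x in std_normal_vec. norm (sqrt (residual_sq i0 x)) \<le> norm (1 + residual_sq i0 x)"
      by simp
  qed measurable
qed

text \<open>Euler's integral after the substitution \<open>t = b * s\<close>. It is read in both
  directions: to write a power of \<open>b\<close> as a mixture of exponentials, and to evaluate
  such a mixture.\<close>

lemma nn_integral_Gamma_scaled:
  fixes a b :: real
  assumes a: "a > 0" and b: "b > 0"
  shows "(\<integral>\<^sup>+s. ennreal (indicator {0..} s * (s powr (a - 1) * exp (- (b * s)))) \<partial>lborel)
    = ennreal (Gamma a / b powr a)"
proof -
  let ?g = "\<lambda>t. ennreal (indicator {0..} t * (t powr (a - 1) / exp t))"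
  have "ennreal (Gamma a) = (\<integral>\<^sup>+t. ?g t \<partial>lborel)"
    using nn_integral_has_integral_lebesgue[OF _ Gamma_integral_real[OF a]] by simp
  also have "\<dots> = ennreal b * (\<integral>\<^sup>+s. ?g (0 + b * s) \<partial>lborel)"
    using b by (subst nn_integral_real_affine[where c=b and t=0]) auto
  also have "(\<integral>\<^sup>+s. ?g (0 + b * s) \<partial>lborel)
    = (\<integral>\<^sup>+s. ennreal (b powr (a - 1)) * ennreal (indicator {0..} s * (s powr (a - 1) * exp (- (b * s)))) \<partial>lborel)"
    using b by (intro nn_integral_cong)
      (auto simp: indicator_def powr_mult exp_minus field_simps zero_le_mult_iff simp flip: ennreal_mult')
  also have "\<dots> = ennreal (b powr (a - 1)) * (\<integral>\<^sup>+s. ennreal (indicator {0..} s * (s powr (a - 1) * exp (- (b * s)))) \<partial>lborel)"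
    by (rule nn_integral_cmult) measurable
  finally have eq: "ennreal (Gamma a) = ennreal (b powr a)
     * (\<integral>\<^sup>+s. ennreal (indicator {0..} s * (s powr (a - 1) * exp (- (b * s)))) \<partial>lborel)"
    using b by (simp add: mult.assoc[symmetric] powr_diff flip: ennreal_mult')
  have "ennreal (Gamma a / b powr a) = ennreal (1 / b powr a) * ennreal (Gamma a)"
    using b by (simp flip: ennreal_mult')
  also have "\<dots> = (\<integral>\<^sup>+s. ennreal (indicator {0..} s * (s powr (a - 1) * exp (- (b * s)))) \<partial>lborel)"
    unfolding eq using b by (simp add: mult.assoc[symmetric] flip: ennreal_mult')
  finally show ?thesis ..
qed

lemma nn_integral_std_normal_exp:
  fixes s :: real
  assumes s: "s \<ge> 0"
  shows "(\<integral>\<^sup>+y. ennreal (std_normal_density y) * ennreal (exp (- (s * y\<^sup>2))) \<partial>lborel)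
      = ennreal ((1 + 2 * s) powr (- 1 / 2))"
    and "(\<integral>\<^sup>+y. ennreal (std_normal_density y) * ennreal (y\<^sup>2 * exp (- (s * y\<^sup>2))) \<partial>lborel)
      = ennreal ((1 + 2 * s) powr (- 3 / 2))"
proof -
  \<comment> \<open>Tilting the standard normal density by \<open>exp (- (s * y\<^sup>2))\<close>
    gives \<open>\<sigma>\<close> times the centred normal density of standard deviation
    \<open>\<sigma>\<close>. The two integrals are therefore \<open>\<sigma>\<close> and
    \<open>\<sigma> * \<sigma>\<^sup>2\<close>.\<close>
  define \<sigma> where "\<sigma> = (1 + 2 * s) powr (- 1 / 2)"
  have sg: "\<sigma> > 0" using s by (simp add: \<sigma>_def)
  have sg1: "\<sigma>\<^sup>2 = (1 + 2 * s) powr (- 1)"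
    unfolding \<sigma>_def using s by (simp flip: powr_realpow add: powr_powr)
  have sg2: "\<sigma>\<^sup>2 = 1 / (1 + 2 * s)" using s by (simp add: sg1 powr_minus_divide)
  have eq: "std_normal_density y * exp (- (s * y\<^sup>2)) = \<sigma> * normal_density 0 \<sigma> y" for y
  proof -
    have "- y\<^sup>2 / 2 + - (s * y\<^sup>2) = - y\<^sup>2 / (2 * \<sigma>\<^sup>2)" using s by (simp add: sg2 field_simps)
    then have "exp (- y\<^sup>2 / 2) * exp (- (s * y\<^sup>2)) = exp (- y\<^sup>2 / (2 * \<sigma>\<^sup>2))"
      by (simp add: exp_add[symmetric])
    then show ?thesis using sg by (simp add: normal_density_def real_sqrt_mult)
  qed
  have "(\<integral>\<^sup>+y. ennreal (std_normal_density y) * ennreal (exp (- (s * y\<^sup>2))) \<partial>lborel)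
     = (\<integral>\<^sup>+y. ennreal (\<sigma> * normal_density 0 \<sigma> y) \<partial>lborel)"
    by (simp add: eq normal_density_nonneg flip: ennreal_mult')
  also have "\<dots> = ennreal (\<integral>y. \<sigma> * normal_density 0 \<sigma> y \<partial>lborel)"
    using sg by (intro nn_integral_eq_integral) (auto simp: normal_density_nonneg)
  finally show "(\<integral>\<^sup>+y. ennreal (std_normal_density y) * ennreal (exp (- (s * y\<^sup>2))) \<partial>lborel)
      = ennreal ((1 + 2 * s) powr (- 1 / 2))"
    using sg by (simp add: \<sigma>_def)
  have "(\<integral>\<^sup>+y. ennreal (std_normal_density y) * ennreal (y\<^sup>2 * exp (- (s * y\<^sup>2))) \<partial>lborel)
     = (\<integral>\<^sup>+y. ennreal (\<sigma> * (normal_density 0 \<sigma> y * (y - 0) ^ (2 * 1))) \<partial>lborel)"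
  proof (intro nn_integral_cong)
    fix y
    have "std_normal_density y * (y\<^sup>2 * exp (- (s * y\<^sup>2))) = (std_normal_density y * exp (- (s * y\<^sup>2))) * y\<^sup>2"
      by (simp only: ac_simps)
    also have "\<dots> = \<sigma> * (normal_density 0 \<sigma> y * (y - 0) ^ (2 * 1))"
      unfolding eq by simp
    finally show "ennreal (std_normal_density y) * ennreal (y\<^sup>2 * exp (- (s * y\<^sup>2)))
      = ennreal (\<sigma> * (normal_density 0 \<sigma> y * (y - 0) ^ (2 * 1)))"
      by (simp only: normal_density_nonneg flip: ennreal_mult')
  qed
  also have "\<dots> = ennreal (\<integral>y. \<sigma> * (normal_density 0 \<sigma> y * (y - 0) ^ (2 * 1)) \<partial>lborel)"
    using sg integrable_normal_moment[OF sg, of 0 2]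
    by (intro nn_integral_eq_integral) (auto simp: normal_density_nonneg)
  also have "(\<integral>y. \<sigma> * (normal_density 0 \<sigma> y * (y - 0) ^ (2 * 1)) \<partial>lborel) = \<sigma> * \<sigma>\<^sup>2"
    by (subst integral_mult_right_zero, subst integral_normal_moment_even[OF sg]) (simp add: fact_2)
  also have "\<sigma> * \<sigma>\<^sup>2 = (1 + 2 * s) powr (- 3 / 2)"
    unfolding sg1 unfolding \<sigma>_def by (subst powr_add[symmetric]) simp
  finally show "(\<integral>\<^sup>+y. ennreal (std_normal_density y) * ennreal (y\<^sup>2 * exp (- (s * y\<^sup>2))) \<partial>lborel)
      = ennreal ((1 + 2 * s) powr (- 3 / 2))" .
qed

text \<open>Each of the \<open>CARD('n) - 1\<close> summands of the leading factor gives a product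
  over independent coordinates: exponent -3/2 from the squared coordinate, -1/2 from each of the
  \<open>CARD('n) - 2\<close> others, nothing from \<open>i0\<close>. The total is
  \<open>- (CARD('n) + 1) / 2\<close>.\<close>

lemma nn_integral_residual_sq_exp:
  fixes i0 :: "'n::finite" and s :: real
  assumes s: "s \<ge> 0"
  shows "(\<integral>\<^sup>+x. ennreal (residual_sq i0 x * exp (- (s * residual_sq i0 x))) \<partial>std_normal_vec)
    = ennreal ((real CARD('n) - 1) * (1 + 2 * s) powr (- ((real CARD('n) + 1) / 2)))"
proof -
  let ?U = "UNIV - {i0}"
  let ?f = "\<lambda>j i y. ennreal (if i = i0 then 1 else if i = j then y\<^sup>2 * exp (- (s * y\<^sup>2)) else exp (- (s * y\<^sup>2)))"
  have pw: "ennreal (residual_sq i0 x * exp (- (s * residual_sq i0 x)))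
    = (\<Sum>j\<in>?U. \<Prod>i\<in>UNIV. ?f j i (x $ i))" for x :: "real^'n"
  proof -
    have "(x $ j)\<^sup>2 * exp (- (s * residual_sq i0 x))
      = (\<Prod>i\<in>UNIV. if i = i0 then 1 else if i = j then (x $ i)\<^sup>2 * exp (- (s * (x $ i)\<^sup>2)) else exp (- (s * (x $ i)\<^sup>2)))"
      if j: "j \<in> ?U" for j
    proof -
      have "exp (- (s * residual_sq i0 x)) = (\<Prod>i\<in>?U. exp (- (s * (x $ i)\<^sup>2)))"
        by (simp add: residual_sq_def sum_distrib_left exp_sum sum_negf[symmetric])
      then have "(x $ j)\<^sup>2 * exp (- (s * residual_sq i0 x))
        = (\<Prod>i\<in>?U. (if i = j then (x $ i)\<^sup>2 else 1) * exp (- (s * (x $ i)\<^sup>2)))"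
        using j by (simp add: prod.distrib)
      also have "\<dots> = (\<Prod>i\<in>?U. if i = i0 then 1 else if i = j then (x $ i)\<^sup>2 * exp (- (s * (x $ i)\<^sup>2)) else exp (- (s * (x $ i)\<^sup>2)))"
        by (intro prod.cong) auto
      also have "\<dots> = (\<Prod>i\<in>UNIV. if i = i0 then 1 else if i = j then (x $ i)\<^sup>2 * exp (- (s * (x $ i)\<^sup>2)) else exp (- (s * (x $ i)\<^sup>2)))"
        by (intro prod.mono_neutral_left) auto
      finally show ?thesis .
    qed
    then have "residual_sq i0 x * exp (- (s * residual_sq i0 x)) = (\<Sum>j\<in>?U. 
      (\<Prod>i\<in>UNIV. if i = i0 then 1 else if i = j then (x $ i)\<^sup>2 * exp (- (s * (x $ i)\<^sup>2)) else exp (- (s * (x $ i)\<^sup>2))))"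
      by (subst (1) residual_sq_def) (simp add: sum_distrib_right)
    then show ?thesis
      by (simp add: sum_ennreal prod_ennreal prod_nonneg)
  qed
  have prod: "(\<integral>\<^sup>+x. (\<Prod>i\<in>UNIV. ?f j i (x $ i)) \<partial>(std_normal_vec :: (real^'n) measure))
    = ennreal ((1 + 2 * s) powr (- ((real CARD('n) + 1) / 2)))" if j: "j \<in> ?U" for j
  proof -
    let ?t = "1 + 2 * s"
    have t: "?t > 0" using s by simp
    have "(\<integral>\<^sup>+x. (\<Prod>i\<in>UNIV. ?f j i (x $ i)) \<partial>(std_normal_vec :: (real^'n) measure))
      = (\<Prod>i\<in>UNIV. \<integral>\<^sup>+y. ennreal (std_normal_density y) * ?f j i y \<partial>lborel)"
      by (rule nn_integral_std_normal_vec_prod) auto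
    also have "\<dots> = (\<Prod>i\<in>UNIV. ennreal (if i = i0 then 1 else if i = j then ?t powr (- 3 / 2) else ?t powr (- 1 / 2)))"
      by (intro prod.cong refl) (simp add: nn_integral_std_normal_exp[OF s])
    also have "\<dots> = ennreal (\<Prod>i\<in>UNIV. if i = i0 then 1 else if i = j then ?t powr (- 3 / 2) else ?t powr (- 1 / 2))"
      by (rule prod_ennreal) auto
    also have "(\<Prod>i\<in>UNIV. if i = i0 then 1 else if i = j then ?t powr (- 3 / 2) else ?t powr (- 1 / 2))
      = ?t powr (\<Sum>i\<in>(UNIV :: 'n set). if i = i0 then 0 else if i = j then - 3 / 2 else - 1 / 2)"
      using t by (subst powr_sum) (auto intro!: prod.cong)
    \<comment> \<open>A uniform exponent -1/2, corrected by +1/2 at \<open>i0\<close> and by -1 at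
      \<open>j\<close>, is summable by \<open>sum.delta\<close>.\<close>
    also have "(\<Sum>i\<in>(UNIV :: 'n set). if i = i0 then 0 else if i = j then - 3 / 2 else - 1 / 2)
      = (\<Sum>i\<in>(UNIV :: 'n set). - 1 / 2 + (if i = i0 then 1 / 2 else 0) + (if i = j then - 1 else 0 :: real))"
      using j by (intro sum.cong) auto
    also have "\<dots> = - ((real CARD('n) + 1) / 2)"
      by (simp only: sum.distrib sum.delta finite_class.finite_UNIV UNIV_I if_True sum_constant) (simp add: field_simps)
    finally show ?thesis .
  qed
  have "(\<integral>\<^sup>+x. ennreal (residual_sq i0 x * exp (- (s * residual_sq i0 x))) \<partial>std_normal_vec)
    = (\<Sum>j\<in>?U. \<integral>\<^sup>+x. (\<Prod>i\<in>UNIV. ?f j i (x $ i)) \<partial>(std_normal_vec :: (real^'n) measure))"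
    unfolding pw by (rule nn_integral_sum) measurable
  also have "\<dots> = (\<Sum>j\<in>?U. ennreal ((1 + 2 * s) powr (- ((real CARD('n) + 1) / 2))))"
    by (intro sum.cong refl prod)
  also have "\<dots> = ennreal (real (card ?U)) * ennreal ((1 + 2 * s) powr (- ((real CARD('n) + 1) / 2)))"
    by (simp add: ennreal_of_nat_eq_real_of_nat)
  also have "real (card ?U) = real CARD('n) - 1" by (simp add: card_Diff_singleton)
  finally show ?thesis by (simp flip: ennreal_mult'')
qed

text \<open>Starting point: \<open>sqrt r = 1 / sqrt pi * (\<integral>s>0. s powr (- 1 / 2) * r * exp (- s * r))\<close>.
  The Gaussian integral over \<open>x\<close> is then elementary, and a second Gamma integral replaces the
  resulting power of \<open>1 + 2 * s\<close> by exponentials.\<close>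

lemma integral_sqrt_residual_sq:
  fixes i0 :: "'n::finite"
  assumes N: "CARD('n) \<ge> 2"
  shows "(\<integral>x. sqrt (residual_sq i0 x) \<partial>std_normal_vec)
    = sqrt 2 * (Gamma (real CARD('n) / 2) / Gamma ((real CARD('n) - 1) / 2))"
proof -
  let ?M = "std_normal_vec :: (real^'n) measure"
  let ?R = "residual_sq i0"
  let ?n = "real CARD('n) - 1"
  let ?q = "(real CARD('n) + 1) / 2"
  interpret prob_space ?M by (rule prob_space_std_normal_vec)
  interpret pair_sigma_finite ?M "lborel :: real measure" by standard
  have q: "?q > 0" and n: "?n > 0" using N by auto
  have Gq: "Gamma ?q > 0" using q by simp
  have Gh: "Gamma (1 / 2 :: real) = sqrt pi" by (rule Gamma_one_half_real)
  \<comment> \<open>Keeping the factor \<open>r\<close> under the integral makes the representation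
    of \<open>sqrt r\<close> valid at \<open>r = 0\<close> too, where the integral without that
    factor diverges.\<close>
  let ?k = "\<lambda>s r. ennreal (indicator {0..} s * (s powr (- 1 / 2) * exp (- (s * r)) * r) / sqrt pi)"
  have root: "(\<integral>\<^sup>+s. ?k s r \<partial>lborel) = ennreal (sqrt r)" if r: "r \<ge> 0" for r
  proof (cases "r = 0")
    case False
    then have r: "r > 0" using r by simp
    have "(\<integral>\<^sup>+s. ?k s r \<partial>lborel)
      = (\<integral>\<^sup>+s. ennreal (r / sqrt pi) * ennreal (indicator {0..} s * (s powr (1 / 2 - 1) * exp (- (r * s)))) \<partial>lborel)"
      using r by (intro nn_integral_cong) (auto simp: indicator_def ac_simps simp flip: ennreal_mult')
    also have "\<dots> = ennreal (r / sqrt pi) * ennreal (Gamma (1 / 2) / r powr (1 / 2))"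
      using nn_integral_Gamma_scaled[of "1 / 2" r] r by (subst nn_integral_cmult) auto
    also have "\<dots> = ennreal (r / sqrt r)"
      using r by (simp add: Gh powr_half_sqrt flip: ennreal_mult')
    finally show ?thesis using r by (simp add: real_div_sqrt)
  qed simp
  have "ennreal (\<integral>x. sqrt (?R x) \<partial>?M) = (\<integral>\<^sup>+x. ennreal (sqrt (?R x)) \<partial>?M)"
    by (rule nn_integral_eq_integral[symmetric]) (auto simp: residual_sq_moments)
  also have "\<dots> = (\<integral>\<^sup>+x. (\<integral>\<^sup>+s. ?k s (?R x) \<partial>lborel) \<partial>?M)"
    by (intro nn_integral_cong root[symmetric] residual_sq_nonneg)
  also have "\<dots> = (\<integral>\<^sup>+s. (\<integral>\<^sup>+x. ?k s (?R x) \<partial>?M) \<partial>lborel)"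
    by (rule Fubini'[symmetric]) measurable
  also have "\<dots> = (\<integral>\<^sup>+s. ennreal (indicator {0..} s * (s powr (- 1 / 2) * (?n * (1 + 2 * s) powr (- ?q))) / sqrt pi) \<partial>lborel)"
  proof (rule nn_integral_cong)
    fix s :: real
    show "(\<integral>\<^sup>+x. ?k s (?R x) \<partial>?M) = ennreal (indicator {0..} s * (s powr (- 1 / 2) * (?n * (1 + 2 * s) powr (- ?q))) / sqrt pi)"
    proof (cases "s \<ge> 0")
      case True
      have "(\<integral>\<^sup>+x. ?k s (?R x) \<partial>?M)
        = (\<integral>\<^sup>+x. ennreal (s powr (- 1 / 2) / sqrt pi) * ennreal (?R x * exp (- (s * ?R x))) \<partial>?M)"
        using True by (intro nn_integral_cong) (auto simp: ac_simps simp flip: ennreal_mult')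
      also have "\<dots> = ennreal (s powr (- 1 / 2) / sqrt pi) * ennreal (?n * (1 + 2 * s) powr (- ?q))"
        using nn_integral_residual_sq_exp[OF True, of i0] by (subst nn_integral_cmult) auto
      finally show ?thesis using True by (simp flip: ennreal_mult')
    qed simp
  qed
  \<comment> \<open>The factor \<open>(1 + 2 * s) powr (- ?q)\<close> is written as
    \<open>1 / Gamma ?q\<close> times an integral over \<open>t\<close>. After exchanging the
    integrals, the one over \<open>s\<close> is again of Gamma type with parameter 1/2, so
    \<open>sqrt pi\<close> cancels and the power \<open>t powr (CARD('n) / 2 - 1)\<close>
    remains.\<close>
  also have "\<dots> = (\<integral>\<^sup>+s. (\<integral>\<^sup>+t. ennreal (?n / (sqrt pi * Gamma ?q)) *
      ennreal (indicator {0..} s * indicator {0..} t * (s powr (- 1 / 2) * (t powr (?q - 1) * exp (- ((1 + 2 * s) * t))))) \<partial>lborel) \<partial>lborel)"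
  proof (rule nn_integral_cong)
    fix s :: real
    show "ennreal (indicator {0..} s * (s powr (- 1 / 2) * (?n * (1 + 2 * s) powr (- ?q))) / sqrt pi)
      = (\<integral>\<^sup>+t. ennreal (?n / (sqrt pi * Gamma ?q)) *
      ennreal (indicator {0..} s * indicator {0..} t * (s powr (- 1 / 2) * (t powr (?q - 1) * exp (- ((1 + 2 * s) * t))))) \<partial>lborel)"
    proof (cases "s \<ge> 0")
      case True
      have "(\<integral>\<^sup>+t. ennreal (?n / (sqrt pi * Gamma ?q)) *
        ennreal (indicator {0..} s * indicator {0..} t * (s powr (- 1 / 2) * (t powr (?q - 1) * exp (- ((1 + 2 * s) * t))))) \<partial>lborel)
        = (\<integral>\<^sup>+t. ennreal (?n / (sqrt pi * Gamma ?q) * s powr (- 1 / 2)) *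
          ennreal (indicator {0..} t * (t powr (?q - 1) * exp (- ((1 + 2 * s) * t)))) \<partial>lborel)"
        using True n Gq by (intro nn_integral_cong) (auto simp: ac_simps simp flip: ennreal_mult')
      also have "\<dots> = ennreal (?n / (sqrt pi * Gamma ?q) * s powr (- 1 / 2)) * ennreal (Gamma ?q / (1 + 2 * s) powr ?q)"
        using nn_integral_Gamma_scaled[OF q, of "1 + 2 * s"] True by (subst nn_integral_cmult) auto
      also have "\<dots> = ennreal (s powr (- 1 / 2) * (?n * (1 + 2 * s) powr (- ?q)) / sqrt pi)"
        using n by (simp add: Gq[THEN less_imp_neq, THEN not_sym] powr_minus_divide flip: ennreal_mult')
      finally show ?thesis using True by simp
    qed simp
  qed
  also have "\<dots> = (\<integral>\<^sup>+t. (\<integral>\<^sup>+s. ennreal (?n / (sqrt pi * Gamma ?q)) *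
      ennreal (indicator {0..} s * indicator {0..} t * (s powr (- 1 / 2) * (t powr (?q - 1) * exp (- ((1 + 2 * s) * t))))) \<partial>lborel) \<partial>lborel)"
    by (rule lborel_pair.Fubini') measurable
  also have "\<dots> = (\<integral>\<^sup>+t. ennreal (?n / (sqrt 2 * Gamma ?q)) *
      ennreal (indicator {0..} t * (t powr (real CARD('n) / 2 - 1) * exp (- (1 * t)))) \<partial>lborel)"
  proof (rule nn_integral_cong)
    fix t :: real
    show "(\<integral>\<^sup>+s. ennreal (?n / (sqrt pi * Gamma ?q)) *
      ennreal (indicator {0..} s * indicator {0..} t * (s powr (- 1 / 2) * (t powr (?q - 1) * exp (- ((1 + 2 * s) * t))))) \<partial>lborel)
      = ennreal (?n / (sqrt 2 * Gamma ?q)) *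
      ennreal (indicator {0..} t * (t powr (real CARD('n) / 2 - 1) * exp (- (1 * t))))"
    proof (cases "t > 0")
      case True
      have "(\<integral>\<^sup>+s. ennreal (?n / (sqrt pi * Gamma ?q)) *
        ennreal (indicator {0..} s * indicator {0..} t * (s powr (- 1 / 2) * (t powr (?q - 1) * exp (- ((1 + 2 * s) * t))))) \<partial>lborel)
        = (\<integral>\<^sup>+s. ennreal (?n / (sqrt pi * Gamma ?q) * (t powr (?q - 1) * exp (- t))) *
          ennreal (indicator {0..} s * (s powr (1 / 2 - 1) * exp (- ((2 * t) * s)))) \<partial>lborel)"
      proof (rule nn_integral_cong)
        fix s
        have "exp (- ((1 + 2 * s) * t)) = exp (- t) * exp (- ((2 * t) * s))"
          by (simp add: algebra_simps flip: exp_add)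
        then show "ennreal (?n / (sqrt pi * Gamma ?q)) *
          ennreal (indicator {0..} s * indicator {0..} t * (s powr (- 1 / 2) * (t powr (?q - 1) * exp (- ((1 + 2 * s) * t)))))
          = ennreal (?n / (sqrt pi * Gamma ?q) * (t powr (?q - 1) * exp (- t))) *
          ennreal (indicator {0..} s * (s powr (1 / 2 - 1) * exp (- ((2 * t) * s))))"
          using True n Gq by (simp add: ac_simps flip: ennreal_mult')
      qed
      also have "\<dots> = ennreal (?n / (sqrt pi * Gamma ?q) * (t powr (?q - 1) * exp (- t))) * ennreal (Gamma (1 / 2) / (2 * t) powr (1 / 2))"
        using nn_integral_Gamma_scaled[of "1 / 2" "2 * t"] True by (subst nn_integral_cmult) auto
      also have "\<dots> = ennreal (?n / (sqrt 2 * Gamma ?q) * (t powr (?q - 1) / t powr (1 / 2) * exp (- t)))"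
        using True n Gq by (simp add: Gh powr_mult powr_half_sqrt flip: ennreal_mult')
      also have "t powr (?q - 1) / t powr (1 / 2) = t powr (real CARD('n) / 2 - 1)"
      proof -
        have "?q - 1 - 1 / 2 = real CARD('n) / 2 - 1" by (simp add: field_simps)
        then show ?thesis by (simp only: powr_diff[symmetric])
      qed
      finally show ?thesis using True n Gq by (simp flip: ennreal_mult')
    next
      case False
      \<comment> \<open>At \<open>t = 0\<close> both sides vanish because
        \<open>0 powr a = 0\<close>, including the exponent \<open>a = 0\<close> that occurs for two
        observations.\<close>
      then show ?thesis by (cases "t = 0") auto
    qed
  qed
  also have "\<dots> = ennreal (?n / (sqrt 2 * Gamma ?q)) * ennreal (Gamma (real CARD('n) / 2) / 1 powr (real CARD('n) / 2))"
    using nn_integral_Gamma_scaled[of "real CARD('n) / 2" 1] N by (subst nn_integral_cmult) auto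
  also have "\<dots> = ennreal (?n / (sqrt 2 * Gamma ?q) * Gamma (real CARD('n) / 2))"
    using n Gq by (simp flip: ennreal_mult')
  finally have e: "ennreal (\<integral>x. sqrt (?R x) \<partial>?M) = ennreal (?n / (sqrt 2 * Gamma ?q) * Gamma (real CARD('n) / 2))" .
  \<comment> \<open>The functional equation of Gamma absorbs the factor \<open>?n\<close> and
    produces the denominator \<open>Gamma (?n / 2)\<close> of \<open>b_N\<close>.\<close>
  have q1: "?q = ?n / 2 + 1" by (simp add: field_simps)
  have "?n / 2 \<notin> \<int>\<^sub>\<le>\<^sub>0" using n by (auto simp: nonpos_Ints_def)
  then have G: "Gamma ?q = ?n / 2 * Gamma (?n / 2)"
    unfolding q1 by (rule Gamma_plus1)
  have Gn: "Gamma (?n / 2) > 0" using n by simp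
  have "(\<integral>x. sqrt (?R x) \<partial>?M) = ?n / (sqrt 2 * Gamma ?q) * Gamma (real CARD('n) / 2)"
    using e n Gq N by (subst (asm) ennreal_inj) auto
  also have "\<dots> = sqrt 2 * (Gamma (real CARD('n) / 2) / Gamma (?n / 2))"
  proof -
    have "a / (sqrt 2 * (a / 2 * g)) * c = (2 / sqrt 2) * (c / g)" if "a > 0" "g > 0" for a g c :: real
      using that by simp
    from this[OF n Gn] show ?thesis by (simp only: G real_div_sqrt zero_le_numeral)
  qed
  finally show ?thesis .
qed

section \<open>The observed process\<close>

lemma borel_measurable_fst_snd:
  "fst \<in> borel_measurable (borel :: (real \<times> real) measure)"
  "snd \<in> borel_measurable (borel :: (real \<times> real) measure)"
  by (intro borel_measurable_continuous_onI continuous_intros)+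

text \<open>The whitening matrix \<open>C\<close> sends the drift direction to the coordinate \<open>i0\<close>: if \<open>Z = C *v y\<close>,
  then \<open>theta_hat\<close> is a multiple of \<open>y $ i0\<close> and \<open>alpha_sq_hat\<close> is built from the remaining
  coordinates.\<close>

locale whitened_model =
  fixes h :: real and m :: nat and H :: "nat \<Rightarrow> real" and k :: "'n::finite \<Rightarrow> nat"
    and C :: "real^'n^'n" and i0 :: 'n
  assumes C_inv: "invertible C"
    and cov_eq: "mixed_cov h m H k = C ** transpose C"
    and times_eq: "obs_times h k = sqrt (d_N h m H k) *\<^sub>R column i0 C"
    and d_pos: "0 < d_N h m H k"
begin

abbreviation d :: real where "d \<equiv> d_N h m H k"
abbreviation T :: "real^'n" where "T \<equiv> obs_times h k"
abbreviation \<Gamma> :: "real^'n^'n" where "\<Gamma> \<equiv> mixed_cov h m H k"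
abbreviation P :: "real \<times> real \<Rightarrow> (real^'n) measure" where "P \<equiv> obs_law h m H k"
abbreviation stat :: "real^'n \<Rightarrow> real \<times> real" where
  "stat \<equiv> \<lambda>Z. (theta_hat h m H k Z, alpha_sq_hat h m H k Z)"

lemma T_eq: "T = C *v (sqrt d *\<^sub>R axis i0 1)"
  by (subst times_eq) (simp only: matrix_vector_mult_scaleR matrix_vector_mult_basis)

lemma inner_cov_inv: "(C *v x) \<bullet> (matrix_inv \<Gamma> *v (C *v y)) = x \<bullet> y"
  unfolding cov_eq by (rule matrix_inv_mult_transpose_vector[OF C_inv])

lemma T_inner_cov_inv: "T \<bullet> (matrix_inv \<Gamma> *v (C *v y)) = sqrt d * y $ i0"
  unfolding T_eq inner_cov_inv by (simp add: inner_axis')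

lemma residual_sq_eq: "residual_sq i0 y = y \<bullet> y - (y $ i0)\<^sup>2"
  by (simp add: residual_sq_def inner_vec_def power2_eq_square sum_diff1)

lemma theta_hat_whitened: "theta_hat h m H k (C *v y) = y $ i0 / sqrt d"
proof -
  have "sqrt d * y $ i0 / d = y $ i0 / (d / sqrt d)" using d_pos by simp
  then show ?thesis
    using d_pos by (simp only: theta_hat_def T_inner_cov_inv real_div_sqrt less_imp_le)
qed

lemma alpha_sq_hat_whitened: "alpha_sq_hat h m H k (C *v y) = residual_sq i0 y / real CARD('n)"
  using d_pos
  by (simp add: alpha_sq_hat_def T_inner_cov_inv inner_cov_inv residual_sq_eq power_mult_distrib)

lemma whitened_surj: obtains y where "z = C *v y"
  using invertible_imp_matrix_inv(1)[OF C_inv] by (metis matrix_vector_mul_assoc matrix_vector_mul_lid)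

lemma alpha_sq_hat_nonneg: "0 \<le> alpha_sq_hat h m H k z"
  by (rule whitened_surj[of z]) (simp add: alpha_sq_hat_whitened)

lemma continuous_cov_inv: "continuous_on UNIV (\<lambda>z :: real^'n. matrix_inv \<Gamma> *v z)"
  by (rule matrix_vector_mult_linear_continuous_on)

lemma theta_hat_measurable [measurable]: "theta_hat h m H k \<in> borel_measurable borel"
  unfolding theta_hat_def[abs_def]
  by (intro borel_measurable_continuous_onI continuous_intros continuous_cov_inv) (use d_pos in simp)

lemma alpha_sq_hat_measurable [measurable]: "alpha_sq_hat h m H k \<in> borel_measurable borel"
  unfolding alpha_sq_hat_def[abs_def]
  by (intro borel_measurable_continuous_onI continuous_intros continuous_cov_inv) (use d_pos in simp)

lemma stat_measurable [measurable]: "stat \<in> borel \<rightarrow>\<^sub>M borel"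
  by measurable

text \<open>Standard noise \<open>x\<close> becomes an observation with drift \<theta> and variance
  parameter \<open>v\<close>. Writing the drift inside \<open>C\<close> lets the formulas in
  whitened coordinates apply directly.\<close>

definition affine :: "real \<Rightarrow> real \<Rightarrow> real^'n \<Rightarrow> real^'n" where
  "affine \<theta> v x = C *v ((\<theta> * sqrt d) *\<^sub>R axis i0 1 + sqrt v *\<^sub>R x)"

lemma affine_measurable [measurable]: "affine \<theta> v \<in> borel_measurable borel"
  unfolding affine_def[abs_def]
  by (intro borel_measurable_continuous_onI
      continuous_on_compose2[OF matrix_vector_mult_linear_continuous_on[of UNIV C]] continuous_intros) auto

lemma scaled_cov_eq:
  assumes "v > 0"
  shows "invertible (sqrt v *\<^sub>R C)"
    and "v *\<^sub>R \<Gamma> = (sqrt v *\<^sub>R C) ** transpose (sqrt v *\<^sub>R C)"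
proof -
  have "(sqrt v *\<^sub>R C) ** ((1 / sqrt v) *\<^sub>R matrix_inv C) = mat 1"
    using assms invertible_imp_matrix_inv(1)[OF C_inv]
    by (simp add: matrix_scalar_ac scalar_matrix_assoc[symmetric])
  then show "invertible (sqrt v *\<^sub>R C)"
    using matrix_left_right_inverse unfolding invertible_def by blast
  show "v *\<^sub>R \<Gamma> = (sqrt v *\<^sub>R C) ** transpose (sqrt v *\<^sub>R C)"
    using assms by (simp add: cov_eq transpose_scalar matrix_scalar_ac scalar_matrix_assoc[symmetric])
qed

lemma obs_law_eq_distr:
  assumes v: "v > 0"
  shows "P (\<theta>, v) = distr std_normal_vec borel (affine \<theta> v)"
proof -
  have "\<theta> *\<^sub>R T + (sqrt v *\<^sub>R C) *v x = affine \<theta> v x" for x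
    by (simp add: affine_def T_eq matrix_vector_right_distrib matrix_scaleR_vector_ac
        scaleR_matrix_vector_assoc[symmetric])
  then show ?thesis
    unfolding obs_law_def using multivariate_normal_eq_distr[OF scaled_cov_eq(1)[OF v], of "\<theta> *\<^sub>R T"]
    by (simp add: scaled_cov_eq(2)[OF v])
qed

lemma theta_hat_affine: "theta_hat h m H k (affine \<theta> v x) = \<theta> + sqrt v / sqrt d * x $ i0"
  unfolding affine_def theta_hat_whitened using d_pos by (simp add: field_simps)

lemma alpha_sq_hat_affine:
  assumes "v > 0"
  shows "alpha_sq_hat h m H k (affine \<theta> v x) = v / real CARD('n) * residual_sq i0 x"
proof -
  have "residual_sq i0 ((\<theta> * sqrt d) *\<^sub>R axis i0 1 + sqrt v *\<^sub>R x) = v * residual_sq i0 x"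
    using assms unfolding residual_sq_def sum_distrib_left
    by (intro sum.cong) (auto simp: axis_def power_mult_distrib)
  then show ?thesis unfolding affine_def alpha_sq_hat_whitened by simp
qed

lemma obs_law_prob_space: "v > 0 \<Longrightarrow> prob_space (P (\<theta>, v))"
  unfolding obs_law_eq_distr
  by (intro prob_space.prob_space_distr prob_space_std_normal_vec) measurable

lemma obs_law_integral:
  fixes f :: "real^'n \<Rightarrow> real"
  assumes "v > 0" and [measurable]: "f \<in> borel_measurable borel"
  shows "integrable (P (\<theta>, v)) f \<longleftrightarrow> integrable std_normal_vec (\<lambda>x. f (affine \<theta> v x))"
    and "integral\<^sup>L (P (\<theta>, v)) f = (\<integral>x. f (affine \<theta> v x) \<partial>std_normal_vec)"
  unfolding obs_law_eq_distr[OF assms(1)] by (subst integrable_distr_eq integral_distr; simp)+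

lemma theta_hat_moments:
  assumes v: "v > 0"
  shows "integrable (P (\<theta>, v)) (theta_hat h m H k)"
    and "integral\<^sup>L (P (\<theta>, v)) (theta_hat h m H k) = \<theta>"
    and "integrable (P (\<theta>, v)) (\<lambda>z. (theta_hat h m H k z)\<^sup>2)"
proof -
  interpret prob_space "std_normal_vec :: (real^'n) measure" by (rule prob_space_std_normal_vec)
  have i: "integrable std_normal_vec (\<lambda>x :: real^'n. x $ i0)"
    "integrable std_normal_vec (\<lambda>x :: real^'n. (x $ i0)\<^sup>2)"
    using std_normal_vec_moments(1)[of i0 1] std_normal_vec_moments(1)[of i0 2] by auto
  show "integrable (P (\<theta>, v)) (theta_hat h m H k)"
    using i by (subst obs_law_integral(1)[OF v]) (auto simp: theta_hat_affine)
  show "integral\<^sup>L (P (\<theta>, v)) (theta_hat h m H k) = \<theta>"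
    using i prob_space by (subst obs_law_integral(2)[OF v]) (auto simp: theta_hat_affine std_normal_vec_moments(2))
  show "integrable (P (\<theta>, v)) (\<lambda>z. (theta_hat h m H k z)\<^sup>2)"
    using i by (subst obs_law_integral(1)[OF v]) (auto simp: theta_hat_affine power2_sum power_mult_distrib power_divide)
qed

lemma alpha_sq_hat_moments:
  assumes v: "v > 0"
  shows "integrable (P (\<theta>, v)) (alpha_sq_hat h m H k)"
    and "integral\<^sup>L (P (\<theta>, v)) (alpha_sq_hat h m H k) = v / real CARD('n) * (real CARD('n) - 1)"
    and "integrable (P (\<theta>, v)) (\<lambda>z. (alpha_sq_hat h m H k z)\<^sup>2)"
  using residual_sq_moments[of i0]
  by (subst obs_law_integral[OF v], simp, simp add: alpha_sq_hat_affine[OF v] power_mult_distrib power_divide)+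

text \<open>The factors \<open>sqrt (v / CARD('n))\<close> and \<open>sqrt 2\<close> of the mean
  combine to \<open>sqrt v\<close> and the \<open>sqrt (2 / N)\<close> of \<open>b_N\<close>. The
  second moment is the first moment of \<open>alpha_sq_hat\<close>.\<close>

lemma alpha_hat_moments:
  assumes v: "v > 0" and card2: "CARD('n) \<ge> 2"
  shows "integrable (P (\<theta>, v)) (alpha_hat h m H k)"
    and "integral\<^sup>L (P (\<theta>, v)) (alpha_hat h m H k) = sqrt v * b_N CARD('n)"
    and "integrable (P (\<theta>, v)) (\<lambda>z. (alpha_hat h m H k z)\<^sup>2)"
proof -
  have [measurable]: "alpha_hat h m H k \<in> borel_measurable borel"
    unfolding alpha_hat_def[abs_def] by measurable
  have a: "alpha_hat h m H k (affine \<theta> v x) = sqrt (v / real CARD('n)) * sqrt (residual_sq i0 x)" for x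
    by (simp add: alpha_hat_def alpha_sq_hat_affine[OF v] real_sqrt_mult real_sqrt_divide)
  show "integrable (P (\<theta>, v)) (alpha_hat h m H k)"
    using residual_sq_moments[of i0] by (subst obs_law_integral(1)[OF v]) (simp_all add: a)
  have "integral\<^sup>L (P (\<theta>, v)) (alpha_hat h m H k)
    = sqrt (v / real CARD('n)) * (sqrt 2 * (Gamma (real CARD('n) / 2) / Gamma ((real CARD('n) - 1) / 2)))"
    using residual_sq_moments[of i0]
    by (subst obs_law_integral(2)[OF v]) (simp_all add: a integral_sqrt_residual_sq[OF card2])
  then show "integral\<^sup>L (P (\<theta>, v)) (alpha_hat h m H k) = sqrt v * b_N CARD('n)"
    by (simp add: b_N_def real_sqrt_divide)
  show "integrable (P (\<theta>, v)) (\<lambda>z. (alpha_hat h m H k z)\<^sup>2)"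
    using alpha_sq_hat_moments(1)[OF v] by (simp add: alpha_hat_def alpha_sq_hat_nonneg)
qed

text \<open>The likelihood ratio with respect to the parameter \<open>(0, 1)\<close>, as a function of the statistic:
  \<open>d * fst s\<close> and \<open>N * snd s + d * (fst s)\<^sup>2\<close> are the natural sufficient statistics,
  where \<open>N = CARD('n)\<close>.\<close>

definition norm_const :: "real \<Rightarrow> real \<Rightarrow> real" where
  "norm_const \<theta> v = sqrt ((2 * pi) ^ CARD('n) * det \<Gamma>) / sqrt ((2 * pi) ^ CARD('n) * det (v *\<^sub>R \<Gamma>))
     * exp (- (\<theta>\<^sup>2 * d / (2 * v)))"

text \<open>The summand 1/2 in the coefficient of the quadratic statistic comes from dividing by the
  density at \<open>(0, 1)\<close>.\<close>

definition lik :: "real \<Rightarrow> real \<Rightarrow> real \<times> real \<Rightarrow> real" where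
  "lik \<theta> v s = norm_const \<theta> v *
     exp (\<theta> / v * (d * fst s) + (1 / 2 - 1 / (2 * v)) * (real CARD('n) * snd s + d * (fst s)\<^sup>2))"

lemma scaled_cov_det_pos: "v > 0 \<Longrightarrow> 0 < det (v *\<^sub>R \<Gamma>)"
  using scaled_cov_eq[of v] by (auto simp: det_mul det_transpose invertible_det_nz zero_less_mult_iff linorder_neq_iff)

lemma norm_const_pos: "v > 0 \<Longrightarrow> 0 < norm_const \<theta> v"
  using scaled_cov_det_pos[of v] scaled_cov_det_pos[of 1] by (simp add: norm_const_def)

lemma lik_measurable [measurable]: "lik \<theta> v \<in> borel_measurable borel"
  unfolding lik_def[abs_def] by (intro borel_measurable_continuous_onI continuous_intros)

lemma lik_nonneg: "v > 0 \<Longrightarrow> 0 \<le> lik \<theta> v s"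
  using norm_const_pos[of v \<theta>] by (simp add: lik_def)

lemma matrix_inv_scaled_cov:
  assumes "v > 0"
  shows "matrix_inv (v *\<^sub>R \<Gamma>) = (1 / v) *\<^sub>R matrix_inv \<Gamma>"
proof (rule matrix_inv_unique)
  have "invertible \<Gamma>" using scaled_cov_det_pos[of 1] by (simp add: invertible_det_nz)
  then show "v *\<^sub>R \<Gamma> ** (1 / v) *\<^sub>R matrix_inv \<Gamma> = mat 1"
    using assms invertible_imp_matrix_inv(1)[of \<Gamma>]
    by (simp add: matrix_scalar_ac scalar_matrix_assoc[symmetric])
qed

lemma obs_law_eq_density:
  assumes v: "v > 0"
  shows "P (\<theta>, v) = density (P (0, 1)) (\<lambda>z. ennreal (lik \<theta> v (stat z)))"
proof -
  define f where "f \<theta> v z = exp (- ((z - \<theta> *\<^sub>R T) \<bullet> (matrix_inv (v *\<^sub>R \<Gamma>) *v (z - \<theta> *\<^sub>R T))) / 2)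
    / sqrt ((2 * pi) ^ CARD('n) * det (v *\<^sub>R \<Gamma>))" for \<theta> v and z :: "real^'n"
  have P: "P (\<theta>, v) = density lborel (\<lambda>z. ennreal (f \<theta> v z))" for \<theta> v
    by (simp add: obs_law_def multivariate_normal_def f_def)
  have "f \<theta> v z = f 0 1 z * lik \<theta> v (stat z)" for z
  proof (rule whitened_surj[of z])
    fix y assume z: "z = C *v y"
    \<comment> \<open>In whitened coordinates the drift has the single entry
      \<open>\<theta> * sqrt d\<close>, so the quadratic form involves only
      \<open>y \<bullet> y\<close> and \<open>y $ i0\<close>; the facts \<open>s\<close> and
      \<open>s'\<close> express both through the statistic.\<close>
    have q: "(z - \<theta> *\<^sub>R T) \<bullet> (matrix_inv (v *\<^sub>R \<Gamma>) *v (z - \<theta> *\<^sub>R T))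
      = (y \<bullet> y - 2 * \<theta> * sqrt d * y $ i0 + \<theta>\<^sup>2 * d) / v" if "v > 0" for \<theta> v
    proof -
      have e: "z - \<theta> *\<^sub>R T = C *v (y - (\<theta> * sqrt d) *\<^sub>R axis i0 1)"
        by (simp add: z T_eq matrix_vector_mult_diff_distrib matrix_scaleR_vector_ac
            scaleR_matrix_vector_assoc[symmetric])
      have "(z - \<theta> *\<^sub>R T) \<bullet> (matrix_inv (v *\<^sub>R \<Gamma>) *v (z - \<theta> *\<^sub>R T))
        = (1 / v) * ((y - (\<theta> * sqrt d) *\<^sub>R axis i0 1) \<bullet> (y - (\<theta> * sqrt d) *\<^sub>R axis i0 1))"
        unfolding e matrix_inv_scaled_cov[OF that]
        by (simp only: scaleR_matrix_vector_assoc[symmetric] inner_scaleR_right inner_cov_inv)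
      also have "(y - (\<theta> * sqrt d) *\<^sub>R axis i0 1) \<bullet> (y - (\<theta> * sqrt d) *\<^sub>R axis i0 1)
        = y \<bullet> y - 2 * \<theta> * sqrt d * y $ i0 + \<theta>\<^sup>2 * d"
      proof -
        have "sqrt d * sqrt d = d" "sqrt d * (sqrt d * w) = d * w" for w
          using d_pos by (simp_all flip: mult.assoc)
        then show ?thesis
          by (simp add: inner_diff_left inner_diff_right inner_axis inner_axis' power2_eq_square algebra_simps)
      qed
      finally show ?thesis by simp
    qed
    have "d * (y $ i0 / sqrt d) = d / sqrt d * y $ i0" by simp
    also have "\<dots> = sqrt d * y $ i0" using d_pos by (simp only: real_div_sqrt less_imp_le)
    finally have s: "d * fst (stat z) = sqrt d * y $ i0" by (simp add: z theta_hat_whitened)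
    have s': "real CARD('n) * snd (stat z) + d * (fst (stat z))\<^sup>2 = y \<bullet> y"
      using d_pos by (simp add: z theta_hat_whitened alpha_sq_hat_whitened residual_sq_eq power_divide)
    have "- ((y \<bullet> y - 2 * \<theta> * sqrt d * y $ i0 + \<theta>\<^sup>2 * d) / v) / 2
      = - (y \<bullet> y) / 2 + (- (\<theta>\<^sup>2 * d / (2 * v))
         + (\<theta> / v * (sqrt d * y $ i0) + (1 / 2 - 1 / (2 * v)) * (y \<bullet> y)))"
      using v by (simp add: field_simps)
    then have "exp (- ((y \<bullet> y - 2 * \<theta> * sqrt d * y $ i0 + \<theta>\<^sup>2 * d) / v) / 2)
      = exp (- (y \<bullet> y) / 2) * (exp (- (\<theta>\<^sup>2 * d / (2 * v)))
         * exp (\<theta> / v * (sqrt d * y $ i0) + (1 / 2 - 1 / (2 * v)) * (y \<bullet> y)))"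
      by (simp only: exp_add)
    then show "f \<theta> v z = f 0 1 z * lik \<theta> v (stat z)"
      using scaled_cov_det_pos[of 1] q[OF v, of \<theta>] q[of 1 0]
      unfolding f_def lik_def s s' norm_const_def by simp
  qed
  moreover have "0 \<le> f 0 1 z" for z using scaled_cov_det_pos[of 1] by (simp add: f_def)
  ultimately have "(\<lambda>z. ennreal (f \<theta> v z)) = (\<lambda>z. ennreal (f 0 1 z) * ennreal (lik \<theta> v (stat z)))"
    by (simp add: ennreal_mult' fun_eq_iff)
  moreover have "f 0 1 \<in> borel_measurable borel"
    unfolding f_def
    by (intro borel_measurable_continuous_onI continuous_intros
        continuous_on_compose2[OF matrix_vector_mult_linear_continuous_on[of UNIV]])
      (use scaled_cov_det_pos[of 1] in auto)
  ultimately show ?thesis unfolding P by (subst density_density_eq) auto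
qed

lemma obs_law_factorized: "factorized_model borel param_space P borel stat"
  unfolding factorized_model_def
proof (intro conjI ballI bexI[of _ "(0, 1)"])
  fix p :: "real \<times> real" assume p: "p \<in> param_space"
  then show "prob_space (P p)" by (cases p) (auto simp: param_space_def intro: obs_law_prob_space)
  show "\<exists>h :: real \<times> real \<Rightarrow> real. h \<in> borel_measurable borel \<and> (\<forall>y. 0 \<le> h y) \<and>
      P p = density (P (0, 1)) (\<lambda>x. ennreal (h (stat x)))"
    using p by (intro exI[of _ "lik (fst p) (snd p)"])
      (auto simp: param_space_def lik_nonneg intro: obs_law_eq_density)
qed (auto simp: obs_law_eq_distr param_space_def)

text \<open>The variables \<open>exp (d * fst s - q)\<close> and \<open>exp (- q)\<close> with \<open>q = N * snd s + d * (fst s)\<^sup>2\<close> are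
  bounded and determine \<open>s\<close>, and each of their monomials is a multiple of a likelihood ratio.\<close>

lemma stat_complete: "complete_statistic borel param_space P borel stat"
  unfolding complete_statistic_def
proof (intro conjI allI impI)
  show "stat \<in> borel \<rightarrow>\<^sub>M borel" by (rule stat_measurable)
  fix g :: "real \<times> real \<Rightarrow> real"
  assume g[measurable]: "g \<in> borel_measurable borel"
    and zero: "\<forall>p\<in>param_space. integrable (P p) (\<lambda>x. g (stat x)) \<and> (\<integral>x. g (stat x) \<partial>P p) = 0"
  let ?M = "P (0, 1)"
  have setsM[measurable_cong]: "sets ?M = sets borel" by (simp add: obs_law_eq_distr)
  define q where "q z = real CARD('n) * snd (stat z) + d * (fst (stat z))\<^sup>2" for z
  define u where "u z = d * fst (stat z)" for z
  have [measurable]: "q \<in> borel_measurable borel" "u \<in> borel_measurable borel"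
    unfolding q_def[abs_def] u_def[abs_def] by measurable
  \<comment> \<open>\<open>exp (u z)\<close> alone is unbounded. Subtracting \<open>q z\<close>,
    which dominates \<open>d * (fst (stat z))\<^sup>2\<close>, bounds it, the maximum of
    \<open>d * x - d * x\<^sup>2\<close> being \<open>d / 4\<close> at
    \<open>x = 1 / 2\<close>.\<close>
  define W where "W z = (exp (u z - q z), exp (- q z))" for z
  have W[measurable]: "W \<in> borel_measurable borel" unfolding W_def[abs_def] by measurable
  have N0: "real CARD('n) > 0" by simp
  have ub: "u z - q z \<le> d / 4" and q0: "q z \<ge> 0" for z
  proof -
    have a: "real CARD('n) * snd (stat z) \<ge> 0" using alpha_sq_hat_nonneg[of z] by simp
    then show "q z \<ge> 0" using d_pos by (simp add: q_def)
    have "0 \<le> d * (fst (stat z) - 1 / 2)\<^sup>2" using d_pos by simp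
    also have "\<dots> = d * (fst (stat z))\<^sup>2 - d * fst (stat z) + d / 4"
      by (simp add: power2_diff power_divide algebra_simps)
    finally show "u z - q z \<le> d / 4" using a by (simp add: q_def u_def)
  qed
  have "AE z in ?M. g (stat z) = 0"
  proof (rule AE_eq_0_of_moments_eq_0[where W=W and K="cbox (0, 0) (exp (d / 4), 1)"])
    show "integrable ?M (\<lambda>z. g (stat z))" using zero by (simp add: param_space_def)
    show "W \<in> borel_measurable ?M" by measurable
    show "compact (cbox (0, 0) (exp (d / 4), 1 :: real))" by (rule compact_cbox)
    show "W z \<in> cbox (0, 0) (exp (d / 4), 1)" for z
      using ub[of z] q0[of z] by (simp add: W_def cbox_Pair_eq)
    show "(\<integral>z. g (stat z) * (fst (W z) ^ i * snd (W z) ^ j) \<partial>?M) = 0" for i j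
    proof -
      \<comment> \<open>The monomial has logarithm \<open>i * u z - (i + j) * q z\<close>. Matching
        the exponent of \<open>lik\<close> requires \<open>\<theta> / v = i\<close> and
        \<open>1 / 2 - 1 / (2 * v) = - (i + j)\<close>, which determines both parameters.\<close>
      define v where "v = 1 / (1 + 2 * real (i + j))"
      define \<theta> where "\<theta> = real i * v"
      have v: "v > 0" by (simp add: v_def add_pos_nonneg)
      have c: "norm_const \<theta> v > 0" by (rule norm_const_pos[OF v])
      have "\<theta> / v = real i" using v by (simp add: \<theta>_def)
      moreover have "1 / 2 - 1 / (2 * v) = - real (i + j)" by (simp add: v_def field_simps)
      ultimately have "lik \<theta> v (stat z) = norm_const \<theta> v * exp (real i * u z + - real (i + j) * q z)" for z
        by (simp only: lik_def u_def q_def)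
      moreover have "fst (W z) ^ i * snd (W z) ^ j = exp (real i * u z + - real (i + j) * q z)" for z
        by (simp add: W_def exp_of_nat_mult[symmetric] algebra_simps flip: exp_add)
      ultimately have w: "lik \<theta> v (stat z) = norm_const \<theta> v * (fst (W z) ^ i * snd (W z) ^ j)" for z
        by simp
      have "0 = (\<integral>z. g (stat z) \<partial>P (\<theta>, v))" using zero v by (simp add: param_space_def)
      also have "\<dots> = (\<integral>z. lik \<theta> v (stat z) * g (stat z) \<partial>?M)"
        unfolding obs_law_eq_density[OF v]
        by (subst integral_density) (auto simp: lik_nonneg[OF v])
      also have "\<dots> = norm_const \<theta> v * (\<integral>z. g (stat z) * (fst (W z) ^ i * snd (W z) ^ j) \<partial>?M)"
        unfolding w by (simp add: ac_simps flip: integral_mult_right_zero)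
      finally show ?thesis using c by simp
    qed
    \<comment> \<open>Inverts \<open>W\<close>: the difference of the logarithms is
      \<open>u z\<close>, which is \<open>d\<close> times the first component of the statistic, and
      \<open>- ln (snd w)\<close> is \<open>q z\<close>, from which the second component
      follows.\<close>
    define \<gamma> where "\<gamma> w = (let a = (ln (fst w) - ln (snd w)) / d in
      g (a, (- ln (snd w) - d * a\<^sup>2) / real CARD('n)))" for w
    note [measurable] = borel_measurable_fst_snd
    show "\<gamma> \<in> borel_measurable borel" unfolding \<gamma>_def[abs_def] Let_def by measurable
    show "g (stat z) = \<gamma> (W z)" for z
      using d_pos N0 by (simp add: \<gamma>_def W_def u_def q_def)
  qed
  show "\<forall>p\<in>param_space. AE x in P p. g (stat x) = 0"
  proof
    fix p :: "real \<times> real" assume "p \<in> param_space"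
    then obtain \<theta> v where p: "p = (\<theta>, v)" "v > 0" by (auto simp: param_space_def)
    show "AE x in P p. g (stat x) = 0"
      unfolding p(1) obs_law_eq_density[OF p(2)]
      using \<open>AE z in ?M. g (stat z) = 0\<close> by (subst AE_density) auto
  qed
qed

lemma umvu_of_moments:
  fixes \<phi> :: "real \<times> real \<Rightarrow> real"
  assumes [measurable]: "\<phi> \<in> borel_measurable borel" and \<delta>: "\<And>z. \<delta> z = \<phi> (stat z)"
    and mom: "\<And>\<theta> v. v > 0 \<Longrightarrow> integrable (P (\<theta>, v)) \<delta> \<and> integral\<^sup>L (P (\<theta>, v)) \<delta> = \<tau> (\<theta>, v)
      \<and> integrable (P (\<theta>, v)) (\<lambda>z. (\<delta> z)\<^sup>2)"
  shows "the_umvu_estimator borel param_space P \<tau> \<delta>"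
proof -
  have eq: "\<delta> = (\<lambda>z. \<phi> (stat z))" using \<delta> by auto
  have "(\<lambda>z. \<phi> (stat z)) \<in> borel_measurable borel" by measurable
  then show ?thesis
    using mom unfolding eq
    by (intro factorized_model_complete_umvu[OF obs_law_factorized stat_complete])
      (auto simp: unbiased_estimator_def param_space_def)
qed

end

theorem theorem3p9:
  fixes h :: real and m N :: nat and H :: "nat \<Rightarrow> real" and k :: "'n::finite \<Rightarrow> nat"
  assumes "h > 0"
    and "m \<ge> 1"
    and "\<forall>r\<in>{1..m}. 1/2 < H r \<and> H r < 1"
    and "N \<ge> 2"
    and "CARD('n) = N"
    and "bij_betw k UNIV {1..N}"
  shows "(sufficient_statistic borel param_space (obs_law h m H k) borel
            (\<lambda>Z. (theta_hat h m H k Z, alpha_sq_hat h m H k Z)) \<and>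
          complete_statistic borel param_space (obs_law h m H k) borel
            (\<lambda>Z. (theta_hat h m H k Z, alpha_sq_hat h m H k Z)))
       \<and> the_umvu_estimator borel param_space (obs_law h m H k) (\<lambda>(\<theta>, \<alpha>2). \<theta>)
            (theta_hat h m H k)
       \<and> the_umvu_estimator borel param_space (obs_law h m H k) (\<lambda>(\<theta>, \<alpha>2). \<alpha>2)
            (\<lambda>Z. real N / (real N - 1) * alpha_sq_hat h m H k Z)
       \<and> the_umvu_estimator borel param_space (obs_law h m H k) (\<lambda>(\<theta>, \<alpha>2). sqrt \<alpha>2)
            (\<lambda>Z. alpha_hat h m H k Z / b_N N)"
proof -
  let ?\<Gamma> = "mixed_cov h m H k" and ?T = "obs_times h k :: real^'n"
  have "k i \<in> {1..N}" for i using assms(6) by (auto simp: bij_betw_def)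
  then have k: "inj k" "0 < k i" for i
    using assms(6) by (auto simp: bij_betw_def Suc_le_eq)
  have pos: "\<forall>z. z \<noteq> 0 \<longrightarrow> 0 < z \<bullet> (?\<Gamma> *v z)"
  proof (intro allI impI)
    fix z :: "real^'n" assume "z \<noteq> 0"
    then show "0 < z \<bullet> (?\<Gamma> *v z)"
    proof (rule mixed_cov_pos_def[OF assms(1,2) _ k, rotated])
      fix r assume "r \<in> {1..m}"
      then have "1/2 < H r \<and> H r < 1" using assms(3) by blast
      then show "0 < H r \<and> H r < 1" by simp
    qed
  qed
  have "?T $ i > 0" for i using k(2)[of i] assms(1) by (simp add: obs_times_def)
  then have T: "?T \<noteq> 0" by (metis less_irrefl zero_index)
  \<comment> \<open>Any coordinate can receive the drift, so an unspecified index suffices.\<close>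
  define i0 :: 'n where "i0 = undefined"
  obtain C where C: "invertible C" "?\<Gamma> = C ** transpose C"
    "?T = sqrt (?T \<bullet> (matrix_inv ?\<Gamma> *v ?T)) *\<^sub>R column i0 C"
    using pos_def_factorization[OF mixed_cov_symmetric pos T, of i0] by blast
  have d: "d_N h m H k = ?T \<bullet> (matrix_inv ?\<Gamma> *v ?T)" by (simp add: d_N_def Let_def)
  interpret whitened_model h m H k C i0
    by unfold_locales
      (fact C(1), fact C(2), unfold d, fact C(3),
        rule pos_def_matrix_inv(2)[OF mixed_cov_symmetric pos, rule_format, OF T])
  have N: "CARD('n) \<ge> 2" "real N > 1" using assms(4,5) by auto
  \<comment> \<open>With at least two observations \<open>(N - 1) / 2\<close> is positive, so both
    Gamma values are positive and division by \<open>b_N N\<close> is legitimate.\<close>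
  have b: "b_N N > 0" using N by (simp add: b_N_def)
  note [measurable] = borel_measurable_fst_snd
  have "the_umvu_estimator borel param_space P (\<lambda>(\<theta>, \<alpha>2). \<theta>) (theta_hat h m H k)"
    by (rule umvu_of_moments[where \<phi>=fst]) (auto simp: theta_hat_moments borel_measurable_fst_snd)
  moreover have "the_umvu_estimator borel param_space P (\<lambda>(\<theta>, \<alpha>2). \<alpha>2)
      (\<lambda>Z. real N / (real N - 1) * alpha_sq_hat h m H k Z)"
    by (rule umvu_of_moments[where \<phi>="\<lambda>s. real N / (real N - 1) * snd s"])
      (use N assms(5) in \<open>auto simp: alpha_sq_hat_moments power_mult_distrib power_divide\<close>)
  moreover have "the_umvu_estimator borel param_space P (\<lambda>(\<theta>, \<alpha>2). sqrt \<alpha>2)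
      (\<lambda>Z. alpha_hat h m H k Z / b_N N)"
  proof (rule umvu_of_moments[where \<phi>="\<lambda>s. sqrt (snd s) / b_N N"])
    show "integrable (P (\<theta>, v)) (\<lambda>Z. alpha_hat h m H k Z / b_N N)
      \<and> (\<integral>Z. alpha_hat h m H k Z / b_N N \<partial>P (\<theta>, v)) = (case (\<theta>, v) of (\<theta>, \<alpha>2) \<Rightarrow> sqrt \<alpha>2)
      \<and> integrable (P (\<theta>, v)) (\<lambda>Z. (alpha_hat h m H k Z / b_N N)\<^sup>2)" if "v > 0" for \<theta> v
      using alpha_hat_moments[OF that N(1)] b assms(5) by (simp add: power_divide)
  qed (simp_all add: alpha_hat_def)
  ultimately show ?thesis
    using factorized_model_sufficient[OF obs_law_factorized] stat_complete by blast
qed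

end
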